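(* In the setting of the context (independent observations $X_1,\dots,X_n$, true parameter value $\theta\in\Theta$, $\Theta\subset\mathbb R$ open, preliminary consistent estimator $\theta_n^*$), suppose the following. (i) With probability $1$, for every $i$, $M_i(t_2,X_i)-M_i(t_1,X_i)=\int_{t_1}^{t_2}M_i'(t,X_i)\,dt$ for every interval $(t_1,t_2)$ lying entirely in $\Theta$; moreover $\mathbf E M_i(\theta,X_i)=0$, $\mathbf E M_i^2(\theta,X_i)<\infty$, $\mathbf E|M_i'(\theta,X_i)|<\infty$ for every $i$. (ii) For all sufficiently large $n$, $I_n:=\sum_{i=1}^n\mathbf E M_i^2(\theta,X_i)>0$ and $J_n:=\sum_{i=1}^n\mathbf E M_i'(\theta,X_i)\ne0$; and as $n\to\infty$: $|J_n|/\sqrt{I_n}\to\infty$, $\sum_{i=1}^nM_i'(\theta,X_i)/J_n\to1$ in probability, $\sum_{i=1}^nM_i(\theta,X_i)/\sqrt{I_n}\Rightarrow\mathcal N(0,1)$. (iii) $\lim_{\delta\to0}\limsup_{n\to\infty}\sum_{i=1}^n\overline\tau_i(\delta)/|J_n|=0$. (iv) $|\theta_n^*-\theta|\sum_{i=1}^n\overline\tau_i(|\theta_n^*-\theta|)/\sqrt{I_n}\to0$ in probability. Then the one-step $M$-estimator $$\theta_n^{**}=\theta_n^*-\frac{\sum_{i=1}^nM_i(\theta_n^*,X_i)}{\sum_{i=1}^nM_i'(\theta_n^*,X_i)}$$ is well defined with probability tending to $1$ as $n\to\infty$, and $$\frac{J_n}{\sqrt{I_n}}\big(\theta_n^{**}-\theta\big)\Longrightarrow\mathcal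 N(0,1).$$ If in addition $\sum_{i=1}^nM_i^2(\theta,X_i)/I_n\to1$ and $\sum_{i=1}^n[M_i'(\theta,X_i)]^2/J_n^2\to0$ in probability, then $$d_n^*\big(\theta_n^{**}-\theta\big)\Longrightarrow\mathcal N(0,1),\qquad\text{where}\quad d_n^*=\frac{\sum_{i=1}^nM_i'(\theta_n^*,X_i)}{\Big(\sum_{i=1}^nM_i^2(\theta_n^{**},X_i)\Big)^{1/2}}.$$
   Context: All limits are as $n\to\infty$ unless stated otherwise; $\Rightarrow$ denotes weak convergence of distributions. For each $n$ one observes independent (not necessarily identically distributed) random elements $X_1,\dots,X_n$ with values in an arbitrary measurable space $\mathcal X$; their distributions depend on an unknown parameter $\theta\in\Theta\subset\mathbb R$, $\Theta$ open, and may depend on $n$ (triangular array) and on nuisance parameters. $\theta$ denotes the fixed true value. For each $i$ there are given real functions $M_i(t,X_i)$, $M_i'(t,X_i)$, $t\in\Theta$ (possibly depending on $n$; $M_i'$ plays the role of the derivative of $M_i$ in $t$). $\theta_n^*$ is a real-valued statistic (function of $X_1,\dots,X_n$), a preliminary estimator consistent for $\theta$. For $\delta\ge0$ put $\overline\tau_i(\delta):=\mathbf E\,\tau_i(\delta,X_i)$, where $\tau_i(\delta,X_i):=\sup_{t:|t-\theta|\le\delta}|M_i'(t,X_i)-M_i'(\theta,X_i)|$ if $[\theta-\delta,\theta+\delta]\subset\Theta$, and $\tau_i(\delta,X_i):=\infty$ otherwise. Here $\overline\tau_i(|\theta_n^*-\theta|)$ means the deterministic function $\overline\tau_i(\cdot)$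 evaluated at the random point $|\theta_n^*-\theta|$. A statistic is "well defined" at a sample point if all quantities in its formula are defined and its denominator is nonzero. *)

theory Defs
  imports "HOL-Probability.Probability"
begin

text \<open>
  The observations form a triangular array: row \<open>n\<close> consists of \<open>X n 1, \<dots>, X n n\<close>, defined on a
  probability space \<open>P n\<close> that may itself depend on \<open>n\<close> (\<open>P n\<close> is the law under the true
  parameter value \<open>\<theta>\<close> and whatever nuisance parameters there are).  The functions of
  row \<open>n\<close> are \<open>M n i t\<close> and \<open>M' n i t\<close>; only their values at \<open>t \<in> \<Theta>\<close> are meaningful.
\<close>

definition sample :: "(nat \<Rightarrow> nat \<Rightarrow> 'w \<Rightarrow> 'x) \<Rightarrow> nat \<Rightarrow> 'w \<Rightarrow> nat \<Rightarrow> 'x" where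
  "sample X n \<omega> = (\<lambda>i\<in>{1..n}. X n i \<omega>)"

definition sample_sum :: "(nat \<Rightarrow> real \<Rightarrow> 'x \<Rightarrow> real) \<Rightarrow> nat \<Rightarrow> real \<Rightarrow> (nat \<Rightarrow> 'x) \<Rightarrow> real" where
  "sample_sum m n t x = (\<Sum>i=1..n. m i t (x i))"

text \<open>\<open>I\<^sub>n\<close> and \<open>J\<^sub>n\<close>.\<close>

definition score_var ::
  "(nat \<Rightarrow> 'w measure) \<Rightarrow> (nat \<Rightarrow> nat \<Rightarrow> 'w \<Rightarrow> 'x) \<Rightarrow> (nat \<Rightarrow> nat \<Rightarrow> real \<Rightarrow> 'x \<Rightarrow> real) \<Rightarrow> real \<Rightarrow> nat \<Rightarrow> real"
  where "score_var P X M \<theta> n = (\<Sum>i=1..n. \<integral>\<omega>. (M n i \<theta> (X n i \<omega>))\<^sup>2 \<partial>P n)"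

definition mean_slope ::
  "(nat \<Rightarrow> 'w measure) \<Rightarrow> (nat \<Rightarrow> nat \<Rightarrow> 'w \<Rightarrow> 'x) \<Rightarrow> (nat \<Rightarrow> nat \<Rightarrow> real \<Rightarrow> 'x \<Rightarrow> real) \<Rightarrow> real \<Rightarrow> nat \<Rightarrow> real"
  where "mean_slope P X M' \<theta> n = (\<Sum>i=1..n. \<integral>\<omega>. M' n i \<theta> (X n i \<omega>) \<partial>P n)"

definition tau :: "real set \<Rightarrow> real \<Rightarrow> (real \<Rightarrow> 'x \<Rightarrow> real) \<Rightarrow> real \<Rightarrow> 'x \<Rightarrow> ennreal" where
  "tau \<Theta> \<theta> m' \<delta> x =
     (if {\<theta> - \<delta>..\<theta> + \<delta>} \<subseteq> \<Theta>
      then (SUP t\<in>{t. \<bar>t - \<theta>\<bar> \<le> \<delta>}. ennreal \<bar>m' t x - m' \<theta> x\<bar>) else \<infinity>)"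

definition tau_bar_sum ::
  "(nat \<Rightarrow> 'w measure) \<Rightarrow> (nat \<Rightarrow> nat \<Rightarrow> 'w \<Rightarrow> 'x) \<Rightarrow> real set \<Rightarrow> real
    \<Rightarrow> (nat \<Rightarrow> nat \<Rightarrow> real \<Rightarrow> 'x \<Rightarrow> real) \<Rightarrow> nat \<Rightarrow> real \<Rightarrow> ennreal"
  where "tau_bar_sum P X \<Theta> \<theta> M' n \<delta> = (\<Sum>i=1..n. \<integral>\<^sup>+\<omega>. tau \<Theta> \<theta> (M' n i) \<delta> (X n i \<omega>) \<partial>P n)"

text \<open>
  The statistics below are functions of the sample \<open>x\<close>; \<open>est\<close> is the preliminary estimator.
  They are partial, and the predicates \<open>_defined\<close> describe their domains.
\<close>

definition one_step ::
  "(nat \<Rightarrow> real \<Rightarrow> 'x \<Rightarrow> real) \<Rightarrow> (nat \<Rightarrow> real \<Rightarrow> 'x \<Rightarrow> real) \<Rightarrow> nat \<Rightarrow> ((nat \<Rightarrow> 'x) \<Rightarrow> real) \<Rightarrow> (nat \<Rightarrow> 'x) \<Rightarrow> real"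
  where "one_step m m' n est x = est x - sample_sum m n (est x) x / sample_sum m' n (est x) x"

definition one_step_defined ::
  "real set \<Rightarrow> (nat \<Rightarrow> real \<Rightarrow> 'x \<Rightarrow> real) \<Rightarrow> nat \<Rightarrow> ((nat \<Rightarrow> 'x) \<Rightarrow> real) \<Rightarrow> (nat \<Rightarrow> 'x) \<Rightarrow> bool"
  where "one_step_defined \<Theta> m' n est x \<longleftrightarrow> est x \<in> \<Theta> \<and> sample_sum m' n (est x) x \<noteq> 0"

definition sq_total ::
  "(nat \<Rightarrow> real \<Rightarrow> 'x \<Rightarrow> real) \<Rightarrow> (nat \<Rightarrow> real \<Rightarrow> 'x \<Rightarrow> real) \<Rightarrow> nat \<Rightarrow> ((nat \<Rightarrow> 'x) \<Rightarrow> real) \<Rightarrow> (nat \<Rightarrow> 'x) \<Rightarrow> real"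
  where "sq_total m m' n est x = sample_sum (\<lambda>i t y. (m i t y)\<^sup>2) n (one_step m m' n est x) x"

definition studentizer ::
  "(nat \<Rightarrow> real \<Rightarrow> 'x \<Rightarrow> real) \<Rightarrow> (nat \<Rightarrow> real \<Rightarrow> 'x \<Rightarrow> real) \<Rightarrow> nat \<Rightarrow> ((nat \<Rightarrow> 'x) \<Rightarrow> real) \<Rightarrow> (nat \<Rightarrow> 'x) \<Rightarrow> real"
  where "studentizer m m' n est x = sample_sum m' n (est x) x / sqrt (sq_total m m' n est x)"

definition studentizer_defined ::
  "real set \<Rightarrow> (nat \<Rightarrow> real \<Rightarrow> 'x \<Rightarrow> real) \<Rightarrow> (nat \<Rightarrow> real \<Rightarrow> 'x \<Rightarrow> real) \<Rightarrow> nat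
    \<Rightarrow> ((nat \<Rightarrow> 'x) \<Rightarrow> real) \<Rightarrow> (nat \<Rightarrow> 'x) \<Rightarrow> bool"
  where "studentizer_defined \<Theta> m m' n est x \<longleftrightarrow>
    one_step_defined \<Theta> m' n est x \<and> one_step m m' n est x \<in> \<Theta> \<and> sq_total m m' n est x \<noteq> 0"

definition conv_in_prob :: "(nat \<Rightarrow> 'w measure) \<Rightarrow> (nat \<Rightarrow> 'w \<Rightarrow> real) \<Rightarrow> real \<Rightarrow> bool" where
  "conv_in_prob P Z c \<longleftrightarrow>
     (\<forall>\<epsilon>>0. (\<lambda>n. measure (P n) {\<omega> \<in> space (P n). \<bar>Z n \<omega> - c\<bar> > \<epsilon>}) \<longlonglongrightarrow> 0)"

text \<open>Convergence to \<open>0\<close> in probability for variables that may take the value \<open>\<infinity>\<close>.\<close>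

definition null_in_prob :: "(nat \<Rightarrow> 'w measure) \<Rightarrow> (nat \<Rightarrow> 'w \<Rightarrow> ennreal) \<Rightarrow> bool" where
  "null_in_prob P Z \<longleftrightarrow>
     (\<forall>\<epsilon>>0. (\<lambda>n. measure (P n) {\<omega> \<in> space (P n). Z n \<omega> > ennreal \<epsilon>}) \<longlonglongrightarrow> 0)"

text \<open>
  Weak convergence to \<open>N(0,1)\<close> of variables \<open>Z n\<close> that are defined only where \<open>D n\<close> holds.
  Where \<open>Z n\<close> is undefined it is given the value \<open>0\<close>.  The normal law has no atom at \<open>0\<close>, so the
  convergence forces the probability of \<open>D n\<close> to tend to \<open>1\<close>, and the choice of the default
  value is immaterial.
\<close>

definition weak_conv_std_normal ::
  "(nat \<Rightarrow> 'w measure) \<Rightarrow> (nat \<Rightarrow> 'w \<Rightarrow> bool) \<Rightarrow> (nat \<Rightarrow> 'w \<Rightarrow> real) \<Rightarrow> bool" where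
  "weak_conv_std_normal P D Z \<longleftrightarrow>
     weak_conv_m (\<lambda>n. distr (P n) borel (\<lambda>\<omega>. if D n \<omega> then Z n \<omega> else 0)) std_normal_distribution"

text \<open>
  The measurability that is needed for the expectations, probabilities and laws in question to
  make sense.  The last three clauses say that the sums entering the one-step estimator and its
  studentization are random variables on their domains; they follow if \<open>M n i\<close> and \<open>M' n i\<close> are
  jointly measurable.  The clause on \<open>tau\<close> is needed because the supremum is uncountable.
\<close>

definition measurability_conditions ::
  "(nat \<Rightarrow> 'w measure) \<Rightarrow> 'x measure \<Rightarrow> (nat \<Rightarrow> nat \<Rightarrow> 'w \<Rightarrow> 'x) \<Rightarrow> real set \<Rightarrow> real
    \<Rightarrow> (nat \<Rightarrow> nat \<Rightarrow> real \<Rightarrow> 'x \<Rightarrow> real) \<Rightarrow> (nat \<Rightarrow> nat \<Rightarrow> real \<Rightarrow> 'x \<Rightarrow> real)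
    \<Rightarrow> (nat \<Rightarrow> (nat \<Rightarrow> 'x) \<Rightarrow> real) \<Rightarrow> bool"
  where "measurability_conditions P S X \<Theta> \<theta> M M' est \<longleftrightarrow>
    (\<forall>n. est n \<in> borel_measurable (PiM {1..n} (\<lambda>_. S))) \<and>
    (\<forall>n. \<forall>i\<in>{1..n}. \<forall>t\<in>\<Theta>. M n i t \<in> borel_measurable S \<and> M' n i t \<in> borel_measurable S) \<and>
    (\<forall>n. \<forall>i\<in>{1..n}. \<forall>\<delta>\<ge>0. (\<lambda>\<omega>. tau \<Theta> \<theta> (M' n i) \<delta> (X n i \<omega>)) \<in> borel_measurable (P n)) \<and>
    (\<forall>n. (\<lambda>\<omega>. sample_sum (M n) n (est n (sample X n \<omega>)) (sample X n \<omega>))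
           \<in> borel_measurable (restrict_space (P n) {\<omega>. est n (sample X n \<omega>) \<in> \<Theta>})) \<and>
    (\<forall>n. (\<lambda>\<omega>. sample_sum (M' n) n (est n (sample X n \<omega>)) (sample X n \<omega>))
           \<in> borel_measurable (restrict_space (P n) {\<omega>. est n (sample X n \<omega>) \<in> \<Theta>})) \<and>
    (\<forall>n. (\<lambda>\<omega>. sq_total (M n) (M' n) n (est n) (sample X n \<omega>))
           \<in> borel_measurable (restrict_space (P n)
                {\<omega>. one_step_defined \<Theta> (M' n) n (est n) (sample X n \<omega>) \<and>
                    one_step (M n) (M' n) n (est n) (sample X n \<omega>) \<in> \<Theta>}))"

end

theory Submission
  imports Defs
begin

text \<open>
  Let \<open>D = \<theta>\<^sub>n\<^sup>* - \<theta>\<close> and let \<open>S(t)\<close> and \<open>T(t)\<close> be the sums of \<open>M\<^sub>i(t, X\<^sub>i)\<close> and \<open>M\<^sub>i'(t, X\<^sub>i)\<close>.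
  One Newton step gives \<open>\<theta>\<^sub>n\<^sup>*\<^sup>* - \<theta> = (D T(\<theta>\<^sub>n\<^sup>*) - S(\<theta>\<^sub>n\<^sup>*)) / T(\<theta>\<^sub>n\<^sup>*)\<close>.  As \<open>S(\<theta>\<^sub>n\<^sup>*) - S(\<theta>)\<close> is the
  integral of \<open>T\<close> from \<open>\<theta>\<close> to \<open>\<theta>\<^sub>n\<^sup>*\<close>, the numerator is \<open>-S(\<theta>)\<close> up to an error of at most
  \<open>2 \<bar>D\<bar> \<Sum>\<^sub>i \<tau>\<^sub>i(\<bar>D\<bar>, X\<^sub>i)\<close>.  If this is negligible relative to \<open>\<surd>I\<^sub>n\<close> (\<open>newton_remainder_tendsto\<close>) and
  \<open>T(\<theta>\<^sub>n\<^sup>*) / J\<^sub>n \<rightarrow> 1\<close> (\<open>slope_est_tendsto\<close>), Slutsky's theorem (\<open>weak_conv_perturb\<close>,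
  \<open>tight_mult_null\<close>) and the symmetry of the normal law yield the limit of
  \<open>J\<^sub>n (\<theta>\<^sub>n\<^sup>*\<^sup>* - \<theta>) / \<surd>I\<^sub>n\<close> (\<open>weak_conv_scaled_error\<close>).

  The delicate point is that the hypothesis on \<open>\<bar>D\<bar> \<Sum>\<^sub>i \<tau>\<^sub>i\<close> concerns the expectations of the \<open>\<tau>\<^sub>i\<close> at
  a fixed radius, into which the random radius \<open>\<bar>D\<bar>\<close> is inserted afterwards, whereas \<open>\<bar>D\<bar>\<close> and
  the \<open>X\<^sub>i\<close> are dependent.  Monotonicity in the radius resolves this: a single exceptional set
  serves in Markov's inequality for all radii with small expectation (\<open>uniform_Markov\<close>).

  For the studentized version, \<open>\<theta>\<^sub>n\<^sup>*\<^sup>*\<close> is now known to be consistent with a tight scaled error.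
  Viewing the roots of the sums of squares as \<open>\<ell>\<^sup>2\<close> norms, the triangle inequality compares
  \<open>\<surd>(\<Sum>\<^sub>i M\<^sub>i\<^sup>2(\<theta>\<^sub>n\<^sup>*\<^sup>*, X\<^sub>i))\<close> with its value at \<open>\<theta>\<close> (\<open>studentizing_variance_tendsto\<close>), so that the
  studentizing factor is equivalent to \<open>J\<^sub>n / \<surd>I\<^sub>n\<close>.
\<close>

section \<open>Convergence in probability as convergence along a filter\<close>

text \<open>
  The filter of events whose probability tends to \<open>1\<close>: convergence in probability becomes ordinary
  convergence along it, so limit laws for sums, products and quotients come for free.  Asking for
  a measurable exceptional set \<open>F\<close> makes it an outer notion.  This matters because some
  quantities of interest, such as \<open>\<tau>\<^sub>i(\<bar>\<theta>\<^sub>n\<^sup>* - \<theta>\<bar>, X\<^sub>i)\<close> with its random radius, need not be measurable.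
\<close>

definition whp :: "(nat \<Rightarrow> 'w measure) \<Rightarrow> (nat \<times> 'w) filter" where
  "whp P = Abs_filter (\<lambda>Q. \<forall>e>0. \<forall>\<^sub>F n in sequentially.
     \<exists>F\<in>sets (P n). emeasure (P n) F \<le> ennreal e \<and> (\<forall>\<omega>\<in>space (P n) - F. Q (n, \<omega>)))"

lemma emeasure_Un_halves:
  assumes "F \<in> sets M" "G \<in> sets M" "emeasure M F \<le> ennreal (e / 2)" "emeasure M G \<le> ennreal (e / 2)"
    and "e > 0"
  shows "emeasure M (F \<union> G) \<le> ennreal e"
proof -
  have "emeasure M (F \<union> G) \<le> emeasure M F + emeasure M G"
    using assms(1,2) by (rule emeasure_subadditive)
  also have "\<dots> \<le> ennreal (e / 2) + ennreal (e / 2)"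
    using assms(3,4) by (rule add_mono)
  also have "\<dots> = ennreal e"
    using \<open>e > 0\<close> by (subst ennreal_plus[symmetric]) auto
  finally show ?thesis .
qed

lemma eventually_whp:
  "eventually Q (whp P) \<longleftrightarrow> (\<forall>e>0. \<forall>\<^sub>F n in sequentially.
     \<exists>F\<in>sets (P n). emeasure (P n) F \<le> ennreal e \<and> (\<forall>\<omega>\<in>space (P n) - F. Q (n, \<omega>)))"
  unfolding whp_def
proof (rule eventually_Abs_filter, rule is_filter.intro, goal_cases)
  case 1
  show ?case
    by (intro allI impI always_eventually bexI[of _ "{}"]) auto
next
  case (2 Q R)
  show ?case
  proof (intro allI impI)
    fix e :: real assume "e > 0"
    then have "e / 2 > 0" by simp
    show "\<forall>\<^sub>F n in sequentially. \<exists>F\<in>sets (P n). emeasure (P n) F \<le> ennreal e \<and>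
        (\<forall>\<omega>\<in>space (P n) - F. Q (n, \<omega>) \<and> R (n, \<omega>))"
      using 2(1)[rule_format, OF \<open>e / 2 > 0\<close>] 2(2)[rule_format, OF \<open>e / 2 > 0\<close>]
    proof eventually_elim
      case (elim n)
      then obtain F G where F: "F \<in> sets (P n)" "emeasure (P n) F \<le> ennreal (e / 2)"
          "\<forall>\<omega>\<in>space (P n) - F. Q (n, \<omega>)"
        and G: "G \<in> sets (P n)" "emeasure (P n) G \<le> ennreal (e / 2)"
          "\<forall>\<omega>\<in>space (P n) - G. R (n, \<omega>)"
        by blast
      have "emeasure (P n) (F \<union> G) \<le> ennreal e"
        using F(1,2) G(1,2) \<open>e > 0\<close> by (intro emeasure_Un_halves) auto
      then show ?case
        using F G by (intro bexI[of _ "F \<union> G"]) auto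
    qed
  qed
next
  case (3 Q R)
  show ?case
  proof (intro allI impI)
    fix e :: real assume "e > 0"
    with 3(2) have "\<forall>\<^sub>F n in sequentially. \<exists>F\<in>sets (P n). emeasure (P n) F \<le> ennreal e \<and>
        (\<forall>\<omega>\<in>space (P n) - F. Q (n, \<omega>))"
      by blast
    then show "\<forall>\<^sub>F n in sequentially. \<exists>F\<in>sets (P n). emeasure (P n) F \<le> ennreal e \<and>
        (\<forall>\<omega>\<in>space (P n) - F. R (n, \<omega>))"
      by (rule eventually_mono) (use 3(1) in blast)
  qed
qed

text \<open>
  Exceptional sets for the passage from \<open>R\<close> to \<open>Q\<close> suffice, and \<open>R\<close> may depend on the tolerance \<open>e\<close>.
  This is the form in which Markov's inequality and tightness enter: they use one truncation level
  per tolerance.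
\<close>

lemma eventually_whpI:
  assumes Q: "\<And>e. e > 0 \<Longrightarrow> \<exists>R. eventually R (whp P) \<and> (\<forall>\<^sub>F n in sequentially.
     \<exists>F\<in>sets (P n). emeasure (P n) F \<le> ennreal e \<and>
        (\<forall>\<omega>\<in>space (P n) - F. R (n, \<omega>) \<longrightarrow> Q (n, \<omega>)))"
  shows "eventually Q (whp P)"
  unfolding eventually_whp
proof (intro allI impI)
  fix e :: real assume "e > 0"
  then have "e / 2 > 0" by simp
  obtain R where R: "eventually R (whp P)" and ev: "\<forall>\<^sub>F n in sequentially.
     \<exists>F\<in>sets (P n). emeasure (P n) F \<le> ennreal (e / 2) \<and>
        (\<forall>\<omega>\<in>space (P n) - F. R (n, \<omega>) \<longrightarrow> Q (n, \<omega>))"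
    using Q[OF \<open>e / 2 > 0\<close>] by blast
  show "\<forall>\<^sub>F n in sequentially. \<exists>F\<in>sets (P n). emeasure (P n) F \<le> ennreal e \<and>
        (\<forall>\<omega>\<in>space (P n) - F. Q (n, \<omega>))"
    using R[unfolded eventually_whp, rule_format, OF \<open>e / 2 > 0\<close>] ev
  proof eventually_elim
    case (elim n)
    then obtain F G where F: "F \<in> sets (P n)" "emeasure (P n) F \<le> ennreal (e / 2)"
        "\<forall>\<omega>\<in>space (P n) - F. R (n, \<omega>)"
      and G: "G \<in> sets (P n)" "emeasure (P n) G \<le> ennreal (e / 2)"
        "\<forall>\<omega>\<in>space (P n) - G. R (n, \<omega>) \<longrightarrow> Q (n, \<omega>)"
      by blast
    have "emeasure (P n) (F \<union> G) \<le> ennreal e"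
      using F(1,2) G(1,2) \<open>e > 0\<close> by (intro emeasure_Un_halves) auto
    then show ?case
      using F G by (intro bexI[of _ "F \<union> G"]) auto
  qed
qed

lemma eventually_whp_AE:
  assumes "\<And>n. AE \<omega> in P n. Q n \<omega>"
  shows "\<forall>\<^sub>F z in whp P. Q (fst z) (snd z)"
  unfolding eventually_whp
proof (intro allI impI always_eventually)
  fix e :: real and n assume "e > 0"
  from assms[of n] obtain N where "{\<omega> \<in> space (P n). \<not> Q n \<omega>} \<subseteq> N" "emeasure (P n) N = 0"
      "N \<in> sets (P n)"
    by (rule AE_E)
  then show "\<exists>F\<in>sets (P n). emeasure (P n) F \<le> ennreal e \<and>
      (\<forall>\<omega>\<in>space (P n) - F. Q (fst (n, \<omega>)) (snd (n, \<omega>)))"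
    by (intro bexI[of _ N]) auto
qed

lemma filterlim_fst_whp: "filterlim fst sequentially (whp P)"
  unfolding filterlim_iff eventually_whp
proof (intro allI impI)
  fix Q :: "nat \<Rightarrow> bool" and e :: real
  assume "eventually Q sequentially"
  then show "\<forall>\<^sub>F n in sequentially. \<exists>F\<in>sets (P n). emeasure (P n) F \<le> ennreal e \<and>
      (\<forall>\<omega>\<in>space (P n) - F. Q (fst (n, \<omega>)))"
    by eventually_elim (intro bexI[of _ "{}"], auto)
qed

lemma eventually_fst_whp:
  "\<forall>\<^sub>F n in sequentially. Q n \<Longrightarrow> \<forall>\<^sub>F z in whp P. Q (fst z)"
  using filterlim_fst_whp[of P] unfolding filterlim_iff by blast

lemma eventually_whp_measure:
  assumes "\<And>n. prob_space (P n)"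
    and "\<forall>\<^sub>F n in sequentially. {\<omega> \<in> space (P n). \<not> Q n \<omega>} \<in> sets (P n)"
    and "(\<lambda>n. measure (P n) {\<omega> \<in> space (P n). \<not> Q n \<omega>}) \<longlonglongrightarrow> 0"
  shows "\<forall>\<^sub>F z in whp P. Q (fst z) (snd z)"
  unfolding eventually_whp
proof (intro allI impI)
  fix e :: real assume "e > 0"
  from assms(2) order_tendstoD(2)[OF assms(3) this]
  show "\<forall>\<^sub>F n in sequentially. \<exists>F\<in>sets (P n). emeasure (P n) F \<le> ennreal e \<and>
      (\<forall>\<omega>\<in>space (P n) - F. Q (fst (n, \<omega>)) (snd (n, \<omega>)))"
  proof eventually_elim
    case (elim n)
    interpret prob_space "P n" by fact
    show ?case
      using elim by (intro bexI[of _ "{\<omega> \<in> space (P n). \<not> Q n \<omega>}"])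
        (auto simp: emeasure_eq_measure ennreal_leI)
  qed
qed

lemma measure_tendsto_1_whp:
  assumes "\<And>n. prob_space (P n)"
    and "\<And>n. {\<omega> \<in> space (P n). Q n \<omega>} \<in> sets (P n)"
    and ev: "\<forall>\<^sub>F z in whp P. Q (fst z) (snd z)"
  shows "(\<lambda>n. measure (P n) {\<omega> \<in> space (P n). Q n \<omega>}) \<longlonglongrightarrow> 1"
proof (rule tendstoI)
  fix e :: real assume "e > 0"
  then have "e / 2 > 0" by simp
  from ev[unfolded eventually_whp, rule_format, OF this]
  show "\<forall>\<^sub>F n in sequentially. dist (measure (P n) {\<omega> \<in> space (P n). Q n \<omega>}) 1 < e"
  proof eventually_elim
    case (elim n)
    interpret prob_space "P n" by fact
    from elim obtain F where F: "F \<in> sets (P n)" "emeasure (P n) F \<le> ennreal (e / 2)"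
        "\<forall>\<omega>\<in>space (P n) - F. Q n \<omega>"
      by auto
    have "prob F \<le> e / 2"
      using F(2) \<open>e > 0\<close> by (simp add: emeasure_eq_measure)
    moreover have "prob (space (P n) - F) \<le> prob {\<omega> \<in> space (P n). Q n \<omega>}"
      by (rule finite_measure_mono) (use F(3) assms(2) in auto)
    moreover have "prob (space (P n) - F) = 1 - prob F"
      using F(1) by (rule prob_compl)
    ultimately show ?case
      using \<open>e > 0\<close> prob_le_1[of "{\<omega> \<in> space (P n). Q n \<omega>}"] by (simp add: dist_real_def)
  qed
qed

lemma tendsto_whp_conv_in_prob:
  assumes "\<And>n. prob_space (P n)"
    and [measurable]: "\<And>n. Z n \<in> borel_measurable (P n)"
    and "conv_in_prob P Z c"
  shows "((\<lambda>z. Z (fst z) (snd z)) \<longlongrightarrow> c) (whp P)"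
proof (rule tendstoI)
  fix e :: real assume "e > 0"
  have "\<forall>\<^sub>F z in whp P. \<not> \<bar>Z (fst z) (snd z) - c\<bar> > e / 2"
  proof (rule eventually_whp_measure)
    show "(\<lambda>n. measure (P n) {\<omega> \<in> space (P n). \<not> \<not> \<bar>Z n \<omega> - c\<bar> > e / 2}) \<longlonglongrightarrow> 0"
      using assms(3)[unfolded conv_in_prob_def, rule_format, of "e / 2"] \<open>e > 0\<close>
      by (simp only: not_not half_gt_zero)
  qed (use assms(1) in auto)
  then show "\<forall>\<^sub>F z in whp P. dist (Z (fst z) (snd z)) c < e"
    by eventually_elim (use \<open>e > 0\<close> in \<open>auto simp: dist_real_def\<close>)
qed

section \<open>Slutsky's theorem\<close>

lemma cdf_distr:
  assumes "V \<in> borel_measurable M"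
  shows "cdf (distr M borel V) x = measure M {\<omega> \<in> space M. V \<omega> \<le> x}"
  using assms by (subst cdf_def2, subst measure_distr) (auto intro!: arg_cong[where f="measure _"])

text \<open>
  Slutsky's theorem for an atomless limit, whose distribution function \<open>\<Phi>\<close> is then continuous.
  Up to a small probability, \<open>{Y \<le> x}\<close> lies between \<open>{Z \<le> x - d/2}\<close> and \<open>{Z \<le> x + d/2}\<close>, and
  continuity makes the limits \<open>\<Phi>(x \<plusminus> d/2)\<close> close to \<open>\<Phi>(x)\<close>.
\<close>

lemma weak_conv_perturb:
  assumes prob: "\<And>n. prob_space (P n)"
    and [measurable]: "\<And>n. Y n \<in> borel_measurable (P n)" "\<And>n. Z n \<in> borel_measurable (P n)"
    and N: "real_distribution N" "\<And>x. measure N {x} = 0"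
    and conv: "weak_conv_m (\<lambda>n. distr (P n) borel (Z n)) N"
    and close: "((\<lambda>z. Y (fst z) (snd z) - Z (fst z) (snd z)) \<longlongrightarrow> 0) (whp P)"
  shows "weak_conv_m (\<lambda>n. distr (P n) borel (Y n)) N"
proof -
  interpret N: real_distribution N by fact
  have cont: "isCont (cdf N) x" for x
    using N(2) by (simp add: N.isCont_cdf)
  have Z: "(\<lambda>n. measure (P n) {\<omega> \<in> space (P n). Z n \<omega> \<le> x}) \<longlonglongrightarrow> cdf N x" for x
    using conv cont[of x] by (simp add: weak_conv_m_def weak_conv_def cdf_distr)
  have "(\<lambda>n. measure (P n) {\<omega> \<in> space (P n). Y n \<omega> \<le> x}) \<longlonglongrightarrow> cdf N x" for x
  proof (rule tendstoI)
    fix e :: real assume "e > 0"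
    then have "e / 3 > 0" by simp
    from cont[of x] this obtain d where d: "d > 0"
        "\<And>y. \<bar>y - x\<bar> < d \<Longrightarrow> \<bar>cdf N y - cdf N x\<bar> < e / 3"
      unfolding continuous_at_real_range by (metis real_norm_def)
    have "\<forall>\<^sub>F z in whp P. \<bar>Y (fst z) (snd z) - Z (fst z) (snd z)\<bar> < d / 2"
      using tendstoD[OF close, of "d / 2"] d(1) by (simp add: dist_real_def)
    from this[unfolded eventually_whp, rule_format, OF \<open>e / 3 > 0\<close>]
      tendstoD[OF Z[of "x + d / 2"] \<open>e / 3 > 0\<close>] tendstoD[OF Z[of "x - d / 2"] \<open>e / 3 > 0\<close>]
    show "\<forall>\<^sub>F n in sequentially. dist (measure (P n) {\<omega> \<in> space (P n). Y n \<omega> \<le> x}) (cdf N x) < e"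
    proof eventually_elim
      case (elim n)
      interpret prob_space "P n" by fact
      from elim(1) obtain F where F: "F \<in> sets (P n)" "emeasure (P n) F \<le> ennreal (e / 3)"
          "\<forall>\<omega>\<in>space (P n) - F. \<bar>Y n \<omega> - Z n \<omega>\<bar> < d / 2"
        by auto
      have F': "prob F \<le> e / 3"
        using F(2) \<open>e > 0\<close> by (simp add: emeasure_eq_measure)
      have "prob {\<omega> \<in> space (P n). Y n \<omega> \<le> x} \<le> prob ({\<omega> \<in> space (P n). Z n \<omega> \<le> x + d / 2} \<union> F)"
      proof (rule finite_measure_mono)
        show "{\<omega> \<in> space (P n). Y n \<omega> \<le> x} \<subseteq> {\<omega> \<in> space (P n). Z n \<omega> \<le> x + d / 2} \<union> F" (is "?L \<subseteq> ?R")
        proof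
          fix \<omega> assume "\<omega> \<in> ?L"
          moreover have "Z n \<omega> \<le> x + d / 2" if "Y n \<omega> \<le> x" "\<bar>Y n \<omega> - Z n \<omega>\<bar> < d / 2"
            using that by linarith
          ultimately show "\<omega> \<in> ?R"
            using F(3) by blast
        qed
      qed (use F(1) in auto)
      also have "\<dots> \<le> prob {\<omega> \<in> space (P n). Z n \<omega> \<le> x + d / 2} + prob F"
        by (rule measure_Un_le) (use F(1) in auto)
      finally have 1: "prob {\<omega> \<in> space (P n). Y n \<omega> \<le> x}
          \<le> prob {\<omega> \<in> space (P n). Z n \<omega> \<le> x + d / 2} + prob F" .
      have "prob {\<omega> \<in> space (P n). Z n \<omega> \<le> x - d / 2} \<le> prob ({\<omega> \<in> space (P n). Y n \<omega> \<le> x} \<union> F)"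
      proof (rule finite_measure_mono)
        show "{\<omega> \<in> space (P n). Z n \<omega> \<le> x - d / 2} \<subseteq> {\<omega> \<in> space (P n). Y n \<omega> \<le> x} \<union> F" (is "?L \<subseteq> ?R")
        proof
          fix \<omega> assume "\<omega> \<in> ?L"
          moreover have "Y n \<omega> \<le> x" if "Z n \<omega> \<le> x - d / 2" "\<bar>Y n \<omega> - Z n \<omega>\<bar> < d / 2"
            using that by linarith
          ultimately show "\<omega> \<in> ?R"
            using F(3) by blast
        qed
      qed (use F(1) in auto)
      also have "\<dots> \<le> prob {\<omega> \<in> space (P n). Y n \<omega> \<le> x} + prob F"
        by (rule measure_Un_le) (use F(1) in auto)
      finally have 2: "prob {\<omega> \<in> space (P n). Z n \<omega> \<le> x - d / 2}
          \<le> prob {\<omega> \<in> space (P n). Y n \<omega> \<le> x} + prob F" .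
      have "\<bar>cdf N (x + d / 2) - cdf N x\<bar> < e / 3" "\<bar>cdf N (x - d / 2) - cdf N x\<bar> < e / 3"
        by (rule d(2); use d(1) in simp)+
      then show ?case
        using 1 2 F' elim(2,3) unfolding dist_real_def by linarith
    qed
  qed
  then show ?thesis
    by (simp add: weak_conv_m_def weak_conv_def cdf_distr)
qed

text \<open>
  A weakly convergent sequence is tight: outside a set of small probability \<open>\<bar>Z\<bar> \<le> K\<close>, where \<open>K\<close> is
  read off from the tails of the limit law.
\<close>

lemma tight_mult_null:
  assumes prob: "\<And>n. prob_space (P n)"
    and [measurable]: "\<And>n. Z n \<in> borel_measurable (P n)"
    and N: "real_distribution N" "\<And>x. measure N {x} = 0"
    and conv: "weak_conv_m (\<lambda>n. distr (P n) borel (Z n)) N"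
    and A: "(A \<longlongrightarrow> (0::real)) (whp P)"
  shows "((\<lambda>z. A z * Z (fst z) (snd z)) \<longlongrightarrow> 0) (whp P)"
proof (rule tendstoI)
  interpret N: real_distribution N by fact
  have cont: "isCont (cdf N) x" for x
    using N(2) by (simp add: N.isCont_cdf)
  have Z: "(\<lambda>n. measure (P n) {\<omega> \<in> space (P n). Z n \<omega> \<le> x}) \<longlonglongrightarrow> cdf N x" for x
    using conv cont[of x] by (simp add: weak_conv_m_def weak_conv_def cdf_distr)
  fix d :: real assume "d > 0"
  show "\<forall>\<^sub>F z in whp P. dist (A z * Z (fst z) (snd z)) 0 < d"
  proof (rule eventually_whpI)
    fix e :: real assume "e > 0"
    have "\<forall>\<^sub>F K in at_top. cdf N K > 1 - e / 4"
      using order_tendstoD(1)[OF N.cdf_lim_at_top_prob, of "1 - e / 4"] \<open>e > 0\<close> by simp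
    moreover have "\<forall>\<^sub>F K in at_top. cdf N (- K) < e / 4"
      using order_tendstoD(2)[OF N.cdf_lim_at_bot, of "e / 4"] \<open>e > 0\<close>
      by (simp add: eventually_at_bot_linorder eventually_at_top_linorder)
        (metis minus_le_iff)
    moreover have "\<forall>\<^sub>F K in at_top. K > (0::real)"
      by (rule eventually_gt_at_top)
    ultimately have "\<forall>\<^sub>F K in at_top. cdf N K > 1 - e / 4 \<and> cdf N (- K) < e / 4 \<and> K > 0"
      by eventually_elim simp
    then obtain K where K: "cdf N K > 1 - e / 4" "cdf N (- K) < e / 4" "K > 0"
      using eventually_happens'[OF trivial_limit_at_top_linorder] by blast
    show "\<exists>R. eventually R (whp P) \<and> (\<forall>\<^sub>F n in sequentially.
        \<exists>F\<in>sets (P n). emeasure (P n) F \<le> ennreal e \<and> (\<forall>\<omega>\<in>space (P n) - F. R (n, \<omega>) \<longrightarrow>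
          dist (A (n, \<omega>) * Z (fst (n, \<omega>)) (snd (n, \<omega>))) 0 < d))"
    proof (intro exI[of _ "\<lambda>z. \<bar>A z\<bar> < d / K"] conjI)
      show "\<forall>\<^sub>F z in whp P. \<bar>A z\<bar> < d / K"
        using tendstoD[OF A, of "d / K"] \<open>d > 0\<close> \<open>K > 0\<close> by (simp add: dist_real_def)
      from order_tendstoD(1)[OF Z K(1)] order_tendstoD(2)[OF Z K(2)]
      show "\<forall>\<^sub>F n in sequentially. \<exists>F\<in>sets (P n). emeasure (P n) F \<le> ennreal e \<and>
         (\<forall>\<omega>\<in>space (P n) - F. \<bar>A (n, \<omega>)\<bar> < d / K \<longrightarrow>
            dist (A (n, \<omega>) * Z (fst (n, \<omega>)) (snd (n, \<omega>))) 0 < d)"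
      proof eventually_elim
        case (elim n)
        interpret prob_space "P n" by fact
        let ?B = "{\<omega> \<in> space (P n). Z n \<omega> \<le> K}" and ?C = "{\<omega> \<in> space (P n). Z n \<omega> \<le> - K}"
        have "prob ((space (P n) - ?B) \<union> ?C) \<le> prob (space (P n) - ?B) + prob ?C"
          by (rule measure_Un_le) auto
        also have "prob (space (P n) - ?B) = 1 - prob ?B"
          by (rule prob_compl) auto
        also have "1 - prob ?B + prob ?C \<le> e"
          using elim \<open>e > 0\<close> by linarith
        finally have "emeasure (P n) ((space (P n) - ?B) \<union> ?C) \<le> ennreal e"
          by (simp add: emeasure_eq_measure ennreal_leI)
        moreover have "\<bar>A (n, \<omega>) * Z n \<omega>\<bar> < d"
          if "\<omega> \<in> space (P n) - ((space (P n) - ?B) \<union> ?C)" "\<bar>A (n, \<omega>)\<bar> < d / K" for \<omega>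
        proof -
          have "\<bar>Z n \<omega>\<bar> \<le> K" using that(1) by auto
          then have "\<bar>A (n, \<omega>)\<bar> * \<bar>Z n \<omega>\<bar> \<le> \<bar>A (n, \<omega>)\<bar> * K"
            by (intro mult_left_mono) auto
          also have "\<dots> < d"
            using that(2) \<open>K > 0\<close> by (simp add: pos_less_divide_eq)
          finally show ?thesis by (simp add: abs_mult)
        qed
        ultimately show ?case
          by (intro bexI[of _ "(space (P n) - ?B) \<union> ?C"]) (auto simp: dist_real_def)
      qed
    qed
  qed
qed

lemma std_normal_atomless: "measure std_normal_distribution {x} = 0"
proof -
  have "{x} \<in> null_sets lborel"
    by (auto simp: null_sets_def)
  moreover have "absolutely_continuous lborel std_normal_distribution"
    by (rule absolutely_continuousI_density) simp
  ultimately have "emeasure std_normal_distribution {x} = 0"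
    unfolding absolutely_continuous_def by blast
  then show ?thesis
    by (simp add: measure_def)
qed

text \<open>
  The characteristic function of the standard normal law is even.
\<close>

lemma weak_conv_std_normal_uminus:
  assumes prob: "\<And>n. prob_space (P n)"
    and [measurable]: "\<And>n. Z n \<in> borel_measurable (P n)"
    and conv: "weak_conv_m (\<lambda>n. distr (P n) borel (Z n)) std_normal_distribution"
  shows "weak_conv_m (\<lambda>n. distr (P n) borel (\<lambda>\<omega>. - Z n \<omega>)) std_normal_distribution"
proof (rule levy_continuity)
  have rd: "real_distribution (distr (P n) borel V)" if "V \<in> borel_measurable (P n)" for n V
    using prob[of n] that by (rule prob_space.real_distribution_distr)
  show "real_distribution (distr (P n) borel (\<lambda>\<omega>. - Z n \<omega>))" for n
    by (rule rd) simp
  show "real_distribution std_normal_distribution"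
    by (rule real_dist_normal_dist)
  fix t
  have "(\<lambda>n. char (distr (P n) borel (Z n)) (- t)) \<longlonglongrightarrow> char std_normal_distribution (- t)"
    by (rule levy_continuity1[OF _ real_dist_normal_dist conv]) (rule rd, simp)
  moreover have "char (distr (P n) borel (Z n)) (- t) = char (distr (P n) borel (\<lambda>\<omega>. - Z n \<omega>)) t" for n
    by (simp add: char_def integral_distr)
  ultimately show "(\<lambda>n. char (distr (P n) borel (\<lambda>\<omega>. - Z n \<omega>)) t) \<longlonglongrightarrow> char std_normal_distribution t"
    by (simp add: char_std_normal_distribution)
qed

section \<open>Markov's inequality at random radii\<close>

lemma cofinal_incseq_real:
  fixes A :: "real set"
  assumes "A \<noteq> {}"
  obtains f :: "nat \<Rightarrow> real" where "incseq f" "range f \<subseteq> A" "\<And>x. x \<in> A \<Longrightarrow> \<exists>k. x \<le> f k"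
proof (cases "\<exists>m\<in>A. \<forall>x\<in>A. x \<le> m")
  case True
  then obtain m where "m \<in> A" "\<And>x. x \<in> A \<Longrightarrow> x \<le> m"
    by blast
  then show ?thesis
    by (intro that[of "\<lambda>_. m"]) auto
next
  case False
  from Sup_countable_SUP[of "ereal ` A"] assms obtain g :: "nat \<Rightarrow> ereal"
    where g: "incseq g" "range g \<subseteq> ereal ` A" "Sup (ereal ` A) = (SUP k. g k)"
    by auto
  then have "\<forall>k. \<exists>x\<in>A. g k = ereal x"
    by blast
  then obtain f where f: "\<And>k. f k \<in> A" "\<And>k. g k = ereal (f k)"
    by metis
  show ?thesis
  proof (rule that[of f])
    show "incseq f"
      using g(1) by (simp add: incseq_def f(2))
    show "range f \<subseteq> A"
      using f(1) by blast
    fix x assume "x \<in> A"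
    with False obtain y where "y \<in> A" "x < y"
      by force
    then have "ereal x < Sup (ereal ` A)"
      by (meson Sup_upper image_eqI less_ereal.simps(1) order_less_le_trans)
    then obtain k where "ereal x < g k"
      unfolding g(3) less_SUP_iff by blast
    then show "\<exists>k. x \<le> f k"
      by (auto simp: f(2) intro: less_imp_le)
  qed
qed

text \<open>
  The decoupling step.  Markov's inequality holds simultaneously for all radii \<open>\<delta>\<close> whose
  expectation \<open>E W(\<delta>)\<close> is below the given level, hence also at a random radius that depends on the
  same data as \<open>W\<close>.  By monotonicity these radii form an interval.  Along an increasing sequence
  that is cofinal in it, \<open>W\<close> increases to some \<open>V\<close>; monotone convergence puts \<open>E V\<close> below the same
  level, and \<open>V\<close> dominates \<open>W(\<delta>)\<close> for all these radii.  Passing to a sequence is needed because the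
  interval need not contain its supremum, and the bound on the expectation may fail there.
\<close>

lemma uniform_Markov:
  fixes W :: "real \<Rightarrow> 'w \<Rightarrow> ennreal"
  assumes meas: "\<And>\<delta>. 0 \<le> \<delta> \<Longrightarrow> W \<delta> \<in> borel_measurable M"
    and mono: "\<And>\<delta> \<delta>' \<omega>. 0 \<le> \<delta> \<Longrightarrow> \<delta> \<le> \<delta>' \<Longrightarrow> W \<delta> \<omega> \<le> W \<delta>' \<omega>"
    and "\<epsilon> > 0" "e \<ge> 0"
  obtains F where "F \<in> sets M" "emeasure M F \<le> ennreal e"
    "\<And>\<omega> \<delta>. \<omega> \<in> space M - F \<Longrightarrow> 0 \<le> \<delta> \<Longrightarrow> (\<integral>\<^sup>+\<omega>. W \<delta> \<omega> \<partial>M) \<le> ennreal (\<epsilon> * e)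
       \<Longrightarrow> W \<delta> \<omega> < ennreal \<epsilon>"
proof -
  define A where "A = {\<delta>. 0 \<le> \<delta> \<and> (\<integral>\<^sup>+\<omega>. W \<delta> \<omega> \<partial>M) \<le> ennreal (\<epsilon> * e)}"
  show ?thesis
  proof (cases "A = {}")
    case True
    then show ?thesis
      by (intro that[of "{}"]) (auto simp: A_def)
  next
    case False
    then obtain f :: "nat \<Rightarrow> real" where f: "incseq f" "range f \<subseteq> A" "\<And>x. x \<in> A \<Longrightarrow> \<exists>k. x \<le> f k"
      by (rule cofinal_incseq_real) blast
    then have nonneg: "0 \<le> f k" and le: "(\<integral>\<^sup>+\<omega>. W (f k) \<omega> \<partial>M) \<le> ennreal (\<epsilon> * e)" for k
      by (auto simp: A_def)
    have [measurable]: "W (f k) \<in> borel_measurable M" for k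
      using nonneg by (rule meas)
    define V where "V \<omega> = (SUP k. W (f k) \<omega>)" for \<omega>
    have [measurable]: "V \<in> borel_measurable M"
      unfolding V_def by measurable
    have "(\<integral>\<^sup>+\<omega>. V \<omega> \<partial>M) = (SUP k. \<integral>\<^sup>+\<omega>. W (f k) \<omega> \<partial>M)"
      unfolding V_def
      by (rule nn_integral_monotone_convergence_SUP)
        (auto simp: incseq_def le_fun_def intro!: mono nonneg incseqD[OF f(1)])
    also have "\<dots> \<le> ennreal (\<epsilon> * e)"
      using le by (rule SUP_least)
    finally have V: "(\<integral>\<^sup>+\<omega>. V \<omega> \<partial>M) \<le> ennreal (\<epsilon> * e)" .
    define F where "F = {\<omega> \<in> space M. 1 \<le> ennreal (1 / \<epsilon>) * V \<omega>}"
    have "emeasure M F \<le> ennreal (1 / \<epsilon>) * (\<integral>\<^sup>+\<omega>. V \<omega> * indicator (space M) \<omega> \<partial>M)"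
      unfolding F_def by (rule nn_integral_Markov_inequality) auto
    also have "(\<integral>\<^sup>+\<omega>. V \<omega> * indicator (space M) \<omega> \<partial>M) = (\<integral>\<^sup>+\<omega>. V \<omega> \<partial>M)"
      by (rule nn_integral_cong) auto
    also have "ennreal (1 / \<epsilon>) * (\<integral>\<^sup>+\<omega>. V \<omega> \<partial>M) \<le> ennreal (1 / \<epsilon>) * ennreal (\<epsilon> * e)"
      by (intro mult_left_mono V) simp
    also have "\<dots> = ennreal e"
      using \<open>\<epsilon> > 0\<close> \<open>e \<ge> 0\<close> by (simp flip: ennreal_mult)
    finally have small: "emeasure M F \<le> ennreal e" .
    show ?thesis
    proof (rule that)
      show "F \<in> sets M"
        unfolding F_def by measurable
      show "emeasure M F \<le> ennreal e"
        by (rule small)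
      fix \<omega> \<delta>
      assume \<omega>: "\<omega> \<in> space M - F" and \<delta>: "0 \<le> \<delta>" "(\<integral>\<^sup>+\<omega>. W \<delta> \<omega> \<partial>M) \<le> ennreal (\<epsilon> * e)"
      then obtain k where "\<delta> \<le> f k"
        using f(3)[of \<delta>] by (auto simp: A_def)
      have "W \<delta> \<omega> \<le> W (f k) \<omega>"
        using \<delta>(1) \<open>\<delta> \<le> f k\<close> by (rule mono)
      also have "\<dots> \<le> V \<omega>"
        unfolding V_def by (rule SUP_upper) simp
      also have "V \<omega> < ennreal \<epsilon>"
      proof (rule ccontr)
        assume "\<not> V \<omega> < ennreal \<epsilon>"
        then have "ennreal (1 / \<epsilon>) * ennreal \<epsilon> \<le> ennreal (1 / \<epsilon>) * V \<omega>"
          by (intro mult_left_mono) auto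
        moreover have "ennreal (1 / \<epsilon>) * ennreal \<epsilon> = 1"
          using \<open>\<epsilon> > 0\<close> by (simp flip: ennreal_mult)
        ultimately show False
          using \<omega> by (auto simp: F_def)
      qed
      finally show "W \<delta> \<omega> < ennreal \<epsilon>" .
    qed
  qed
qed

lemma ennreal_divide_le_iff:
  assumes "c > 0" "r \<ge> 0"
  shows "x / ennreal c \<le> ennreal r \<longleftrightarrow> x \<le> ennreal (r * c)"
proof (cases x)
  case (real y)
  then show ?thesis
    using assms by (simp add: divide_ennreal ennreal_le_iff pos_divide_le_eq)
next
  case top
  then show ?thesis
    using assms by (simp add: ennreal_top_divide top_unique)
qed

section \<open>Linearization of a single score\<close>

lemma tau_mono:
  assumes "\<delta> \<le> \<delta>'"
  shows "tau \<Theta> \<theta> m' \<delta> x \<le> tau \<Theta> \<theta> m' \<delta>' x"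
proof (cases "{\<theta> - \<delta>'..\<theta> + \<delta>'} \<subseteq> \<Theta>")
  case True
  moreover have "{\<theta> - \<delta>..\<theta> + \<delta>} \<subseteq> {\<theta> - \<delta>'..\<theta> + \<delta>'}"
    using assms by auto
  ultimately have "{\<theta> - \<delta>..\<theta> + \<delta>} \<subseteq> \<Theta>"
    by blast
  with True show ?thesis
    using assms by (auto simp: tau_def intro!: SUP_subset_mono)
next
  case False
  then show ?thesis
    by (simp add: tau_def)
qed

lemma tau_bound:
  assumes fin: "tau \<Theta> \<theta> m' \<delta> x \<noteq> \<infinity>" and t: "\<bar>t - \<theta>\<bar> \<le> \<delta>"
  shows "\<bar>m' t x - m' \<theta> x\<bar> \<le> enn2real (tau \<Theta> \<theta> m' \<delta> x)"
proof -
  have "ennreal \<bar>m' t x - m' \<theta> x\<bar> \<le> tau \<Theta> \<theta> m' \<delta> x"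
    using fin t by (auto simp: tau_def split: if_splits intro!: SUP_upper2[of t])
  then show ?thesis
    using fin enn2real_mono[of "ennreal \<bar>m' t x - m' \<theta> x\<bar>" "tau \<Theta> \<theta> m' \<delta> x"]
    by (simp add: less_top)
qed

lemma set_integral_near_constant:
  fixes g :: "real \<Rightarrow> real"
  assumes "a \<le> b" and int: "set_integrable lborel {a..b} g"
    and close: "\<And>t. t \<in> {a..b} \<Longrightarrow> \<bar>g t - y\<bar> \<le> c"
  shows "\<bar>(LBINT t:{a..b}. g t) - (b - a) * y\<bar> \<le> (b - a) * c"
proof -
  have const: "set_integrable lborel {a..b} (\<lambda>_. r)" "(LBINT t:{a..b}. r) = (b - a) * r" for r :: real
    using \<open>a \<le> b\<close> by (auto simp: set_integral_const set_integrable_def)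
  have "(LBINT t:{a..b}. y - c) \<le> (LBINT t:{a..b}. g t)"
    by (rule set_integral_mono[OF const(1) int]) (use close in \<open>fastforce simp: abs_le_iff\<close>)
  moreover have "(LBINT t:{a..b}. g t) \<le> (LBINT t:{a..b}. y + c)"
    by (rule set_integral_mono[OF int const(1)]) (use close in \<open>fastforce simp: abs_le_iff\<close>)
  ultimately show ?thesis
    unfolding const(2) by (simp add: abs_le_iff algebra_simps)
qed

text \<open>
  The fundamental theorem of calculus writes the difference as the integral of
  \<open>m'(s) - m'(\<theta>)\<close> over \<open>s\<close> between \<open>\<theta>\<close> and \<open>t\<close>.
\<close>

lemma linearization_error:
  assumes deriv: "\<And>t1 t2. t1 \<le> t2 \<Longrightarrow> {t1..t2} \<subseteq> \<Theta> \<Longrightarrow>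
      set_integrable lborel {t1..t2} (\<lambda>t. m' t x) \<and>
      m t2 x - m t1 x = (LBINT t:{t1..t2}. m' t x)"
    and fin: "tau \<Theta> \<theta> m' \<delta> x \<noteq> \<infinity>" and t: "\<bar>t - \<theta>\<bar> \<le> \<delta>"
  shows "\<bar>m t x - m \<theta> x - (t - \<theta>) * m' \<theta> x\<bar> \<le> \<bar>t - \<theta>\<bar> * enn2real (tau \<Theta> \<theta> m' \<delta> x)"
proof -
  have sub: "{\<theta> - \<delta>..\<theta> + \<delta>} \<subseteq> \<Theta>"
    using fin by (auto simp: tau_def split: if_splits)
  let ?a = "min t \<theta>" and ?b = "max t \<theta>"
  have "{?a..?b} \<subseteq> {\<theta> - \<delta>..\<theta> + \<delta>}"
    using t by auto
  then have "{?a..?b} \<subseteq> \<Theta>"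
    using sub by blast
  then have int: "set_integrable lborel {?a..?b} (\<lambda>t. m' t x)"
    and eq: "m ?b x - m ?a x = (LBINT t:{?a..?b}. m' t x)"
    using deriv[of ?a ?b] by auto
  have "\<bar>(LBINT s:{?a..?b}. m' s x) - (?b - ?a) * m' \<theta> x\<bar> \<le> (?b - ?a) * enn2real (tau \<Theta> \<theta> m' \<delta> x)"
    using _ int
    by (rule set_integral_near_constant) (use t in \<open>auto intro!: tau_bound[OF fin]\<close>)
  also have "?b - ?a = \<bar>t - \<theta>\<bar>"
    by auto
  finally have "\<bar>m ?b x - m ?a x - \<bar>t - \<theta>\<bar> * m' \<theta> x\<bar> \<le> \<bar>t - \<theta>\<bar> * enn2real (tau \<Theta> \<theta> m' \<delta> x)"
    by (simp only: eq)
  moreover have "\<bar>m ?b x - m ?a x - \<bar>t - \<theta>\<bar> * m' \<theta> x\<bar> = \<bar>m t x - m \<theta> x - (t - \<theta>) * m' \<theta> x\<bar>"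
    by (cases "\<theta> \<le> t") (simp_all add: max_def min_def abs_if algebra_simps)
  ultimately show ?thesis
    by simp
qed

lemma abs_diff_L2_set_le: "\<bar>L2_set f A - L2_set g A\<bar> \<le> L2_set (\<lambda>i. f i - g i) A"
proof -
  have "L2_set f A \<le> L2_set (\<lambda>i. f i - g i) A + L2_set g A"
    using L2_set_triangle_ineq[of "\<lambda>i. f i - g i" g A] by simp
  moreover have "L2_set g A \<le> L2_set (\<lambda>i. g i - f i) A + L2_set f A"
    using L2_set_triangle_ineq[of "\<lambda>i. g i - f i" f A] by simp
  moreover have "L2_set (\<lambda>i. g i - f i) A = L2_set (\<lambda>i. f i - g i) A"
    by (simp add: L2_set_def power2_commute)
  ultimately show ?thesis
    by linarith
qed

lemma L2_set_cmult: "L2_set (\<lambda>i. c * f i) A = \<bar>c\<bar> * L2_set f A"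
  by (simp add: L2_set_def power_mult_distrib sum_distrib_left[symmetric] real_sqrt_mult)

section \<open>The array of scores and its measurability\<close>

locale M_estimation =
  fixes P :: "nat \<Rightarrow> 'w measure" and S :: "'x measure" and X :: "nat \<Rightarrow> nat \<Rightarrow> 'w \<Rightarrow> 'x"
    and \<Theta> :: "real set" and \<theta> :: real
    and M M' :: "nat \<Rightarrow> nat \<Rightarrow> real \<Rightarrow> 'x \<Rightarrow> real"
    and est :: "nat \<Rightarrow> (nat \<Rightarrow> 'x) \<Rightarrow> real"
  assumes prob: "\<And>n. prob_space (P n)"
    and X_meas: "\<And>n i. i \<in> {1..n} \<Longrightarrow> X n i \<in> measurable (P n) S"
    and Theta: "open \<Theta>" "\<theta> \<in> \<Theta>"
    and meas: "measurability_conditions P S X \<Theta> \<theta> M M' est"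
    and consistent: "conv_in_prob P (\<lambda>n \<omega>. est n (sample X n \<omega>)) \<theta>"
    and deriv: "\<And>n. AE \<omega> in P n. \<forall>i\<in>{1..n}. \<forall>t1 t2. t1 \<le> t2 \<longrightarrow> {t1..t2} \<subseteq> \<Theta> \<longrightarrow>
          set_integrable lborel {t1..t2} (\<lambda>t. M' n i t (X n i \<omega>)) \<and>
          M n i t2 (X n i \<omega>) - M n i t1 (X n i \<omega>) = (LBINT t:{t1..t2}. M' n i t (X n i \<omega>))"
    and pos: "\<forall>\<^sub>F n in sequentially. score_var P X M \<theta> n > 0 \<and> mean_slope P X M' \<theta> n \<noteq> 0"
    and ratio: "filterlim (\<lambda>n. \<bar>mean_slope P X M' \<theta> n\<bar> / sqrt (score_var P X M \<theta> n))
          at_top sequentially"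
    and slope: "conv_in_prob P
          (\<lambda>n \<omega>. sample_sum (M' n) n \<theta> (sample X n \<omega>) / mean_slope P X M' \<theta> n) 1"
    and clt: "weak_conv_m (\<lambda>n. distr (P n) borel
          (\<lambda>\<omega>. sample_sum (M n) n \<theta> (sample X n \<omega>) / sqrt (score_var P X M \<theta> n))) std_normal_distribution"
    and osc: "((\<lambda>\<delta>. limsup (\<lambda>n. tau_bar_sum P X \<Theta> \<theta> M' n \<delta> / ennreal \<bar>mean_slope P X M' \<theta> n\<bar>))
          \<longlongrightarrow> 0) (at_right 0)"
    and osc_est: "null_in_prob P (\<lambda>n \<omega>.
          ennreal \<bar>est n (sample X n \<omega>) - \<theta>\<bar>
            * tau_bar_sum P X \<Theta> \<theta> M' n \<bar>est n (sample X n \<omega>) - \<theta>\<bar>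
            / ennreal (sqrt (score_var P X M \<theta> n)))"
begin

abbreviation I :: "nat \<Rightarrow> real" where "I \<equiv> score_var P X M \<theta>"
abbreviation J :: "nat \<Rightarrow> real" where "J \<equiv> mean_slope P X M' \<theta>"
abbreviation hp :: "(nat \<times> 'w) filter" where "hp \<equiv> whp P"

definition estv :: "nat \<Rightarrow> 'w \<Rightarrow> real" where
  "estv n \<omega> = est n (sample X n \<omega>)"

definition score :: "nat \<Rightarrow> real \<Rightarrow> 'w \<Rightarrow> real" where
  "score n t \<omega> = sample_sum (M n) n t (sample X n \<omega>)"

definition slope_sum :: "nat \<Rightarrow> real \<Rightarrow> 'w \<Rightarrow> real" where
  "slope_sum n t \<omega> = sample_sum (M' n) n t (sample X n \<omega>)"

definition tau_sum :: "nat \<Rightarrow> real \<Rightarrow> 'w \<Rightarrow> ennreal" where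
  "tau_sum n \<delta> \<omega> = (\<Sum>i=1..n. tau \<Theta> \<theta> (M' n i) \<delta> (X n i \<omega>))"

definition antiderivatives :: "nat \<Rightarrow> 'w \<Rightarrow> bool" where
  "antiderivatives n \<omega> \<longleftrightarrow> (\<forall>i\<in>{1..n}. \<forall>t1 t2. t1 \<le> t2 \<longrightarrow> {t1..t2} \<subseteq> \<Theta> \<longrightarrow>
          set_integrable lborel {t1..t2} (\<lambda>t. M' n i t (X n i \<omega>)) \<and>
          M n i t2 (X n i \<omega>) - M n i t1 (X n i \<omega>) = (LBINT t:{t1..t2}. M' n i t (X n i \<omega>)))"

lemma sample_sum_sample: "sample_sum m n t (sample X n \<omega>) = (\<Sum>i=1..n. m i t (X n i \<omega>))"
  by (simp add: sample_sum_def sample_def)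

lemma sample_meas: "sample X n \<in> measurable (P n) (PiM {1..n} (\<lambda>_. S))"
  unfolding sample_def by (rule measurable_restrict) (rule X_meas)

lemma estv_meas [measurable]: "estv n \<in> borel_measurable (P n)"
  unfolding estv_def using meas
  by (intro measurable_compose[OF sample_meas]) (simp add: measurability_conditions_def)

lemma summand_meas:
  assumes "i \<in> {1..n}"
  shows "(\<lambda>\<omega>. M n i \<theta> (X n i \<omega>)) \<in> borel_measurable (P n)"
    and "(\<lambda>\<omega>. M' n i \<theta> (X n i \<omega>)) \<in> borel_measurable (P n)"
  using meas assms Theta(2)
  by (auto intro!: measurable_compose[OF X_meas] simp: measurability_conditions_def)

lemma score_meas [measurable]: "score n \<theta> \<in> borel_measurable (P n)"
  unfolding score_def sample_sum_sample by (intro borel_measurable_sum summand_meas)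

lemma slope_sum_meas [measurable]: "slope_sum n \<theta> \<in> borel_measurable (P n)"
  unfolding slope_sum_def sample_sum_sample by (intro borel_measurable_sum summand_meas)

lemma tau_sum_meas: "0 \<le> \<delta> \<Longrightarrow> tau_sum n \<delta> \<in> borel_measurable (P n)"
  using meas unfolding tau_sum_def
  by (intro borel_measurable_sum) (simp add: measurability_conditions_def)

lemma nn_integral_tau_sum:
  assumes "0 \<le> \<delta>"
  shows "(\<integral>\<^sup>+\<omega>. tau_sum n \<delta> \<omega> \<partial>P n) = tau_bar_sum P X \<Theta> \<theta> M' n \<delta>"
  unfolding tau_bar_sum_def tau_sum_def using meas assms
  by (intro nn_integral_sum) (simp add: measurability_conditions_def)

lemma tau_sum_mono: "\<delta> \<le> \<delta>' \<Longrightarrow> tau_sum n \<delta> \<omega> \<le> tau_sum n \<delta>' \<omega>"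
  unfolding tau_sum_def by (intro sum_mono tau_mono)

lemma tau_bar_sum_mono: "\<delta> \<le> \<delta>' \<Longrightarrow> tau_bar_sum P X \<Theta> \<theta> M' n \<delta> \<le> tau_bar_sum P X \<Theta> \<theta> M' n \<delta>'"
  unfolding tau_bar_sum_def by (intro sum_mono nn_integral_mono tau_mono)

lemma eventually_antiderivatives: "\<forall>\<^sub>F z in hp. antiderivatives (fst z) (snd z)"
  unfolding antiderivatives_def by (rule eventually_whp_AE) (rule deriv)

lemma eventually_pos: "\<forall>\<^sub>F z in hp. I (fst z) > 0 \<and> J (fst z) \<noteq> 0"
  using pos by (rule eventually_fst_whp)

lemma estv_tendsto: "((\<lambda>z. estv (fst z) (snd z)) \<longlongrightarrow> \<theta>) hp"
  using consistent by (intro tendsto_whp_conv_in_prob prob estv_meas) (simp add: estv_def)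

section \<open>Oscillation of the slopes at random radii\<close>

text \<open>
  The radius \<open>\<bar>D\<bar>\<close> is eventually below a fixed \<open>\<delta>\<close>, where Markov's inequality applies to a
  deterministic radius; the condition on \<open>limsup\<close> provides a \<open>\<delta>\<close> for the given tolerance.
\<close>

lemma tau_sum_le_slope:
  assumes D: "(D \<longlongrightarrow> 0) hp" and "\<epsilon> > 0"
  shows "\<forall>\<^sub>F z in hp. tau_sum (fst z) \<bar>D z\<bar> (snd z) < ennreal (\<epsilon> * \<bar>J (fst z)\<bar>)"
proof (rule eventually_whpI)
  fix e :: real assume "e > 0"
  have "\<forall>\<^sub>F \<delta> in at_right 0.
      limsup (\<lambda>n. tau_bar_sum P X \<Theta> \<theta> M' n \<delta> / ennreal \<bar>J n\<bar>) < ennreal (\<epsilon> * e)"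
    using \<open>e > 0\<close> \<open>\<epsilon> > 0\<close> by (intro order_tendstoD(2)[OF osc]) simp
  then have "\<forall>\<^sub>F \<delta> in at_right 0. \<delta> > 0 \<and>
      limsup (\<lambda>n. tau_bar_sum P X \<Theta> \<theta> M' n \<delta> / ennreal \<bar>J n\<bar>) < ennreal (\<epsilon> * e)"
    by (intro eventually_conj eventually_at_right_less)
  then obtain \<delta> where \<delta>: "\<delta> > 0"
      "limsup (\<lambda>n. tau_bar_sum P X \<Theta> \<theta> M' n \<delta> / ennreal \<bar>J n\<bar>) < ennreal (\<epsilon> * e)"
    using eventually_happens'[OF trivial_limit_at_right_real] by blast
  show "\<exists>R. eventually R hp \<and> (\<forall>\<^sub>F n in sequentially.
      \<exists>F\<in>sets (P n). emeasure (P n) F \<le> ennreal e \<and> (\<forall>\<omega>\<in>space (P n) - F. R (n, \<omega>) \<longrightarrow>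
        tau_sum (fst (n, \<omega>)) \<bar>D (n, \<omega>)\<bar> (snd (n, \<omega>)) < ennreal (\<epsilon> * \<bar>J (fst (n, \<omega>))\<bar>)))"
  proof (intro exI[of _ "\<lambda>z. \<bar>D z\<bar> < \<delta>"] conjI)
    show "\<forall>\<^sub>F z in hp. \<bar>D z\<bar> < \<delta>"
      using tendstoD[OF D \<delta>(1)] by simp
    from Limsup_lessD[OF \<delta>(2)] pos
    show "\<forall>\<^sub>F n in sequentially. \<exists>F\<in>sets (P n). emeasure (P n) F \<le> ennreal e \<and>
      (\<forall>\<omega>\<in>space (P n) - F. \<bar>D (n, \<omega>)\<bar> < \<delta> \<longrightarrow>
        tau_sum (fst (n, \<omega>)) \<bar>D (n, \<omega>)\<bar> (snd (n, \<omega>)) < ennreal (\<epsilon> * \<bar>J (fst (n, \<omega>))\<bar>))"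
    proof eventually_elim
      case (elim n)
      have "tau_bar_sum P X \<Theta> \<theta> M' n \<delta> \<le> ennreal (\<epsilon> * e * \<bar>J n\<bar>)"
        using elim \<open>e > 0\<close> \<open>\<epsilon> > 0\<close> by (subst ennreal_divide_le_iff[symmetric]) auto
      then have int: "(\<integral>\<^sup>+\<omega>. tau_sum n \<delta> \<omega> \<partial>P n) \<le> ennreal (\<epsilon> * \<bar>J n\<bar> * e)"
        using \<delta>(1) by (simp add: nn_integral_tau_sum mult_ac)
      obtain F where F: "F \<in> sets (P n)" "emeasure (P n) F \<le> ennreal e"
        "\<And>\<omega> \<delta>. \<omega> \<in> space (P n) - F \<Longrightarrow> 0 \<le> \<delta> \<Longrightarrow>
          (\<integral>\<^sup>+\<omega>. tau_sum n \<delta> \<omega> \<partial>P n) \<le> ennreal (\<epsilon> * \<bar>J n\<bar> * e) \<Longrightarrow>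
          tau_sum n \<delta> \<omega> < ennreal (\<epsilon> * \<bar>J n\<bar>)"
        by (rule uniform_Markov[of "tau_sum n" "P n" "\<epsilon> * \<bar>J n\<bar>" e])
          (use elim \<open>e > 0\<close> \<open>\<epsilon> > 0\<close> tau_sum_meas tau_sum_mono in auto)
      show ?case
      proof (intro bexI[of _ F] conjI ballI impI F(1,2))
        fix \<omega> assume "\<omega> \<in> space (P n) - F" "\<bar>D (n, \<omega>)\<bar> < \<delta>"
        then have "tau_sum n \<bar>D (n, \<omega>)\<bar> \<omega> \<le> tau_sum n \<delta> \<omega>"
          by (intro tau_sum_mono) simp
        also have "\<dots> < ennreal (\<epsilon> * \<bar>J n\<bar>)"
          using F(3)[OF \<open>\<omega> \<in> space (P n) - F\<close> _ int] \<delta>(1) by simp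
        finally show "tau_sum (fst (n, \<omega>)) \<bar>D (n, \<omega>)\<bar> (snd (n, \<omega>)) < ennreal (\<epsilon> * \<bar>J (fst (n, \<omega>))\<bar>)"
          by simp
      qed
    qed
  qed
qed

text \<open>
  The hypothesis inserts the random radius into the expectations of the \<open>\<tau>\<^sub>i\<close>; the claim is about the
  variables \<open>\<tau>\<^sub>i\<close> themselves at that radius, which depends on the same observations.  The uniform
  Markov inequality for \<open>\<delta> \<Sum>\<^sub>i \<tau>\<^sub>i(\<delta>, X\<^sub>i)\<close> passes from the former to the latter.
\<close>

lemma weighted_tau_sum_le:
  assumes "\<epsilon> > 0"
  shows "\<forall>\<^sub>F z in hp. ennreal \<bar>estv (fst z) (snd z) - \<theta>\<bar>
      * tau_sum (fst z) \<bar>estv (fst z) (snd z) - \<theta>\<bar> (snd z) < ennreal (\<epsilon> * sqrt (I (fst z)))"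
proof (rule eventually_whpI)
  fix e :: real assume "e > 0"
  define H where "H n \<delta> = ennreal \<delta> * tau_bar_sum P X \<Theta> \<theta> M' n \<delta> / ennreal (sqrt (I n))" for n \<delta>
  have H_mono: "H n \<delta> \<le> H n \<delta>'" if "\<delta> \<le> \<delta>'" for n \<delta> \<delta>'
    unfolding H_def using that
    by (intro divide_right_mono_ennreal mult_mono tau_bar_sum_mono ennreal_leI) auto
  let ?D = "\<lambda>n \<omega>. \<bar>estv n \<omega> - \<theta>\<bar>"
  have "\<forall>\<^sub>F z in hp. \<not> H (fst z) (?D (fst z) (snd z)) > ennreal (\<epsilon> * e)"
  proof (rule eventually_whp_measure[OF prob])
    have "{\<omega> \<in> space (P n). \<not> \<not> H n (?D n \<omega>) > ennreal (\<epsilon> * e)} \<in> sets (P n)" for n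
    proof -
      \<comment> \<open>Borel measurability in the radius comes from monotonicity.\<close>
      have "is_interval {\<delta>. ennreal (\<epsilon> * e) < H n \<delta>}"
        unfolding is_interval_1 using H_mono order_less_le_trans by blast
      then have [measurable]: "{\<delta>. ennreal (\<epsilon> * e) < H n \<delta>} \<in> sets borel"
        by (rule real_interval_borel_measurable)
      have "{\<omega> \<in> space (P n). ?D n \<omega> \<in> {\<delta>. ennreal (\<epsilon> * e) < H n \<delta>}} \<in> sets (P n)"
        by measurable
      then show ?thesis
        by simp
    qed
    then show "\<forall>\<^sub>F n in sequentially.
        {\<omega> \<in> space (P n). \<not> \<not> H n (?D n \<omega>) > ennreal (\<epsilon> * e)} \<in> sets (P n)"
      by simp
    show "(\<lambda>n. measure (P n) {\<omega> \<in> space (P n). \<not> \<not> H n (?D n \<omega>) > ennreal (\<epsilon> * e)}) \<longlonglongrightarrow> 0"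
      using osc_est[unfolded null_in_prob_def, rule_format, of "\<epsilon> * e"] \<open>\<epsilon> > 0\<close> \<open>e > 0\<close>
      by (simp only: H_def estv_def not_not mult_pos_pos)
  qed
  moreover have "\<forall>\<^sub>F n in sequentially. \<exists>F\<in>sets (P n). emeasure (P n) F \<le> ennreal e \<and>
      (\<forall>\<omega>\<in>space (P n) - F. \<not> H (fst (n, \<omega>)) (?D (fst (n, \<omega>)) (snd (n, \<omega>))) > ennreal (\<epsilon> * e) \<longrightarrow>
         ennreal (?D (fst (n, \<omega>)) (snd (n, \<omega>))) *
           tau_sum (fst (n, \<omega>)) (?D (fst (n, \<omega>)) (snd (n, \<omega>))) (snd (n, \<omega>))
           < ennreal (\<epsilon> * sqrt (I (fst (n, \<omega>)))))"
    using pos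
  proof eventually_elim
    case (elim n)
    have int: "(\<integral>\<^sup>+\<omega>. ennreal \<delta> * tau_sum n \<delta> \<omega> \<partial>P n) = ennreal \<delta> * tau_bar_sum P X \<Theta> \<theta> M' n \<delta>"
      if "0 \<le> \<delta>" for \<delta>
      using that by (simp add: nn_integral_cmult tau_sum_meas nn_integral_tau_sum)
    obtain F where F: "F \<in> sets (P n)" "emeasure (P n) F \<le> ennreal e"
        "\<And>\<omega> \<delta>. \<omega> \<in> space (P n) - F \<Longrightarrow> 0 \<le> \<delta> \<Longrightarrow>
          (\<integral>\<^sup>+\<omega>. ennreal \<delta> * tau_sum n \<delta> \<omega> \<partial>P n) \<le> ennreal (\<epsilon> * sqrt (I n) * e) \<Longrightarrow>
          ennreal \<delta> * tau_sum n \<delta> \<omega> < ennreal (\<epsilon> * sqrt (I n))"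
    proof (rule uniform_Markov[of "\<lambda>\<delta> \<omega>. ennreal \<delta> * tau_sum n \<delta> \<omega>" "P n" "\<epsilon> * sqrt (I n)" e])
      show "(\<lambda>\<omega>. ennreal \<delta> * tau_sum n \<delta> \<omega>) \<in> borel_measurable (P n)" if "0 \<le> \<delta>" for \<delta>
        using tau_sum_meas[OF that] by simp
      show "ennreal \<delta> * tau_sum n \<delta> \<omega> \<le> ennreal \<delta>' * tau_sum n \<delta>' \<omega>"
        if "0 \<le> \<delta>" "\<delta> \<le> \<delta>'" for \<delta> \<delta>' \<omega>
        using that by (intro mult_mono tau_sum_mono ennreal_leI) auto
    qed (use elim \<open>e > 0\<close> \<open>\<epsilon> > 0\<close> in auto)
    show ?case
    proof (intro bexI[of _ F] conjI ballI impI F(1,2))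
      fix \<omega> assume "\<omega> \<in> space (P n) - F"
        and H: "\<not> H (fst (n, \<omega>)) (?D (fst (n, \<omega>)) (snd (n, \<omega>))) > ennreal (\<epsilon> * e)"
      have "ennreal (?D n \<omega>) * tau_bar_sum P X \<Theta> \<theta> M' n (?D n \<omega>) \<le> ennreal (\<epsilon> * e * sqrt (I n))"
        using H elim \<open>e > 0\<close> \<open>\<epsilon> > 0\<close>
        by (subst ennreal_divide_le_iff[symmetric]) (auto simp: H_def)
      then have "(\<integral>\<^sup>+\<omega>'. ennreal (?D n \<omega>) * tau_sum n (?D n \<omega>) \<omega>' \<partial>P n) \<le> ennreal (\<epsilon> * sqrt (I n) * e)"
        by (simp add: int mult_ac)
      from F(3)[OF \<open>\<omega> \<in> space (P n) - F\<close> _ this]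
      show "ennreal (?D (fst (n, \<omega>)) (snd (n, \<omega>))) *
           tau_sum (fst (n, \<omega>)) (?D (fst (n, \<omega>)) (snd (n, \<omega>))) (snd (n, \<omega>))
           < ennreal (\<epsilon> * sqrt (I (fst (n, \<omega>))))"
        by simp
    qed
  qed
  ultimately show "\<exists>R. eventually R hp \<and> (\<forall>\<^sub>F n in sequentially.
      \<exists>F\<in>sets (P n). emeasure (P n) F \<le> ennreal e \<and> (\<forall>\<omega>\<in>space (P n) - F. R (n, \<omega>) \<longrightarrow>
        ennreal (?D (fst (n, \<omega>)) (snd (n, \<omega>))) *
           tau_sum (fst (n, \<omega>)) (?D (fst (n, \<omega>)) (snd (n, \<omega>))) (snd (n, \<omega>))
           < ennreal (\<epsilon> * sqrt (I (fst (n, \<omega>))))))"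
    by (intro exI[of _ "\<lambda>z. \<not> H (fst z) (?D (fst z) (snd z)) > ennreal (\<epsilon> * e)"] conjI)
qed

lemma sum_enn2real_tau:
  assumes "tau_sum n \<delta> \<omega> < \<infinity>"
  shows "(\<Sum>i=1..n. enn2real (tau \<Theta> \<theta> (M' n i) \<delta> (X n i \<omega>))) = enn2real (tau_sum n \<delta> \<omega>)"
    and "i \<in> {1..n} \<Longrightarrow> tau \<Theta> \<theta> (M' n i) \<delta> (X n i \<omega>) \<noteq> \<infinity>"
proof -
  have fin: "tau \<Theta> \<theta> (M' n i) \<delta> (X n i \<omega>) < \<top>" if "i \<in> {1..n}" for i
    using assms that by (auto simp: tau_sum_def)
  then show "i \<in> {1..n} \<Longrightarrow> tau \<Theta> \<theta> (M' n i) \<delta> (X n i \<omega>) \<noteq> \<infinity>"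
    unfolding infinity_ennreal_def less_top .
  show "(\<Sum>i=1..n. enn2real (tau \<Theta> \<theta> (M' n i) \<delta> (X n i \<omega>))) = enn2real (tau_sum n \<delta> \<omega>)"
    unfolding tau_sum_def using fin by (subst enn2real_sum) auto
qed

lemma slope_sum_osc:
  assumes "tau_sum n \<delta> \<omega> < \<infinity>" "\<bar>t - \<theta>\<bar> \<le> \<delta>"
  shows "\<bar>slope_sum n t \<omega> - slope_sum n \<theta> \<omega>\<bar> \<le> enn2real (tau_sum n \<delta> \<omega>)"
proof -
  have "\<bar>slope_sum n t \<omega> - slope_sum n \<theta> \<omega>\<bar>
      \<le> (\<Sum>i=1..n. \<bar>M' n i t (X n i \<omega>) - M' n i \<theta> (X n i \<omega>)\<bar>)"
    unfolding slope_sum_def sample_sum_sample sum_subtractf[symmetric] by (rule sum_abs)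
  also have "\<dots> \<le> (\<Sum>i=1..n. enn2real (tau \<Theta> \<theta> (M' n i) \<delta> (X n i \<omega>)))"
    using sum_enn2real_tau(2)[OF assms(1)] assms(2) by (intro sum_mono tau_bound) auto
  finally show ?thesis
    by (simp only: sum_enn2real_tau(1)[OF assms(1)])
qed

text \<open>
  Bounding the sum of the absolute errors, and not just the error of the sum, gives the
  \<open>\<ell>\<^sup>2\<close> estimate needed for studentization as well.
\<close>

lemma sum_linearization_error:
  assumes "antiderivatives n \<omega>" "tau_sum n \<delta> \<omega> < \<infinity>" "\<bar>t - \<theta>\<bar> \<le> \<delta>"
  shows "(\<Sum>i=1..n. \<bar>M n i t (X n i \<omega>) - M n i \<theta> (X n i \<omega>) - (t - \<theta>) * M' n i \<theta> (X n i \<omega>)\<bar>)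
    \<le> \<bar>t - \<theta>\<bar> * enn2real (tau_sum n \<delta> \<omega>)"
proof -
  have "(\<Sum>i=1..n. \<bar>M n i t (X n i \<omega>) - M n i \<theta> (X n i \<omega>) - (t - \<theta>) * M' n i \<theta> (X n i \<omega>)\<bar>)
      \<le> (\<Sum>i=1..n. \<bar>t - \<theta>\<bar> * enn2real (tau \<Theta> \<theta> (M' n i) \<delta> (X n i \<omega>)))"
    using assms(1,3) sum_enn2real_tau(2)[OF assms(2)]
    by (intro sum_mono linearization_error) (auto simp: antiderivatives_def)
  then show ?thesis
    by (simp only: sum_enn2real_tau(1)[OF assms(2)] sum_distrib_left[symmetric])
qed

lemma score_linearization_error:
  assumes "antiderivatives n \<omega>" "tau_sum n \<delta> \<omega> < \<infinity>" "\<bar>t - \<theta>\<bar> \<le> \<delta>"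
  shows "\<bar>score n t \<omega> - score n \<theta> \<omega> - (t - \<theta>) * slope_sum n \<theta> \<omega>\<bar>
    \<le> \<bar>t - \<theta>\<bar> * enn2real (tau_sum n \<delta> \<omega>)"
proof -
  have "score n t \<omega> - score n \<theta> \<omega> - (t - \<theta>) * slope_sum n \<theta> \<omega> =
     (\<Sum>i=1..n. M n i t (X n i \<omega>) - M n i \<theta> (X n i \<omega>) - (t - \<theta>) * M' n i \<theta> (X n i \<omega>))"
    by (simp add: score_def slope_sum_def sample_sum_sample sum_subtractf sum_distrib_left)
  then show ?thesis
    using order_trans[OF sum_abs sum_linearization_error[OF assms]] by simp
qed

lemma tau_sum_ratio_tendsto:
  assumes D: "(D \<longlongrightarrow> 0) hp"
  shows "((\<lambda>z. enn2real (tau_sum (fst z) \<bar>D z\<bar> (snd z)) / \<bar>J (fst z)\<bar>) \<longlongrightarrow> 0) hp"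
    and "\<forall>\<^sub>F z in hp. tau_sum (fst z) \<bar>D z\<bar> (snd z) < \<infinity>"
proof -
  show "((\<lambda>z. enn2real (tau_sum (fst z) \<bar>D z\<bar> (snd z)) / \<bar>J (fst z)\<bar>) \<longlongrightarrow> 0) hp"
  proof (rule tendstoI)
    fix \<epsilon> :: real assume "\<epsilon> > 0"
    from tau_sum_le_slope[OF D this] eventually_pos
    show "\<forall>\<^sub>F z in hp. dist (enn2real (tau_sum (fst z) \<bar>D z\<bar> (snd z)) / \<bar>J (fst z)\<bar>) 0 < \<epsilon>"
    proof eventually_elim
      case (elim z)
      then have "enn2real (tau_sum (fst z) \<bar>D z\<bar> (snd z)) < \<epsilon> * \<bar>J (fst z)\<bar>"
        using \<open>\<epsilon> > 0\<close> by (simp add: enn2real_less_iff order_less_trans[OF _ ennreal_less_top])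
      then show ?case
        using elim by (simp add: pos_divide_less_eq)
    qed
  qed
  show "\<forall>\<^sub>F z in hp. tau_sum (fst z) \<bar>D z\<bar> (snd z) < \<infinity>"
    using tau_sum_le_slope[OF D zero_less_one]
    by eventually_elim (auto intro: order_less_trans[OF _ ennreal_less_top])
qed

lemma est_error_tendsto: "((\<lambda>z. estv (fst z) (snd z) - \<theta>) \<longlongrightarrow> 0) hp"
  using estv_tendsto by (simp add: LIM_zero_iff)

lemma weighted_tau_sum_tendsto:
  "((\<lambda>z. \<bar>estv (fst z) (snd z) - \<theta>\<bar> *
      enn2real (tau_sum (fst z) \<bar>estv (fst z) (snd z) - \<theta>\<bar> (snd z)) / sqrt (I (fst z))) \<longlongrightarrow> 0) hp"
proof (rule tendstoI)
  fix \<epsilon> :: real assume "\<epsilon> > 0"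
  from weighted_tau_sum_le[OF this] eventually_pos
  show "\<forall>\<^sub>F z in hp. dist (\<bar>estv (fst z) (snd z) - \<theta>\<bar> *
      enn2real (tau_sum (fst z) \<bar>estv (fst z) (snd z) - \<theta>\<bar> (snd z)) / sqrt (I (fst z))) 0 < \<epsilon>"
  proof eventually_elim
    case (elim z)
    let ?D = "\<bar>estv (fst z) (snd z) - \<theta>\<bar>"
    have "enn2real (ennreal ?D * tau_sum (fst z) ?D (snd z)) < \<epsilon> * sqrt (I (fst z))"
      using elim \<open>\<epsilon> > 0\<close>
      by (simp add: enn2real_less_iff order_less_trans[OF _ ennreal_less_top])
    then show ?case
      using elim by (simp add: enn2real_mult pos_divide_less_eq abs_mult)
  qed
qed

lemma slope_est_tendsto:
  "((\<lambda>z. slope_sum (fst z) (estv (fst z) (snd z)) (snd z) / J (fst z)) \<longlongrightarrow> 1) hp"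
proof -
  let ?b = "\<lambda>z. slope_sum (fst z) (estv (fst z) (snd z)) (snd z) / J (fst z)"
  let ?a = "\<lambda>z. slope_sum (fst z) \<theta> (snd z) / J (fst z)"
  have a: "(?a \<longlongrightarrow> 1) hp"
  proof (rule tendsto_whp_conv_in_prob[OF prob])
    show "(\<lambda>\<omega>. slope_sum n \<theta> \<omega> / J n) \<in> borel_measurable (P n)" for n
      by measurable
    show "conv_in_prob P (\<lambda>n \<omega>. slope_sum n \<theta> \<omega> / J n) 1"
      using slope by (simp only: slope_sum_def)
  qed
  have "((\<lambda>z. ?b z - ?a z) \<longlongrightarrow> 0) hp"
  proof (rule Lim_null_comparison[OF _ tau_sum_ratio_tendsto(1)[OF est_error_tendsto]])
    show "\<forall>\<^sub>F z in hp. norm (?b z - ?a z)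
        \<le> enn2real (tau_sum (fst z) \<bar>estv (fst z) (snd z) - \<theta>\<bar> (snd z)) / \<bar>J (fst z)\<bar>"
      using tau_sum_ratio_tendsto(2)[OF est_error_tendsto]
    proof eventually_elim
      case (elim z)
      show ?case
        using slope_sum_osc[OF elim order_refl]
        by (simp add: diff_divide_distrib[symmetric] abs_divide divide_right_mono)
    qed
  qed
  from tendsto_add[OF this a] show ?thesis
    by simp
qed

text \<open>
  The remainder of one Newton step started at the estimator, in units of \<open>\<surd>I\<^sub>n\<close>: the distance
  between the score at \<open>\<theta>\<close> and the value at \<open>\<theta>\<close> of its tangent at the estimator, up to sign.
\<close>

definition newton_remainder :: "nat \<Rightarrow> 'w \<Rightarrow> real" where
  "newton_remainder n \<omega> = (score n (estv n \<omega>) \<omega> - score n \<theta> \<omega>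
      - (estv n \<omega> - \<theta>) * slope_sum n (estv n \<omega>) \<omega>) / sqrt (I n)"

text \<open>
  Replacing the slope at the estimator by the slope at \<open>\<theta>\<close> costs the oscillation of the slope, and
  the remainder with slope at \<open>\<theta>\<close> is the linearization error; each is at most
  \<open>\<bar>\<theta>\<^sub>n\<^sup>* - \<theta>\<bar> \<Sum>\<^sub>i \<tau>\<^sub>i(\<bar>\<theta>\<^sub>n\<^sup>* - \<theta>\<bar>, X\<^sub>i)\<close>.
\<close>

lemma newton_remainder_tendsto: "((\<lambda>z. newton_remainder (fst z) (snd z)) \<longlongrightarrow> 0) hp"
proof (rule Lim_null_comparison)
  let ?w = "\<lambda>z. \<bar>estv (fst z) (snd z) - \<theta>\<bar> *
      enn2real (tau_sum (fst z) \<bar>estv (fst z) (snd z) - \<theta>\<bar> (snd z)) / sqrt (I (fst z))"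
  show "((\<lambda>z. 2 * ?w z) \<longlongrightarrow> 0) hp"
    using tendsto_mult_left[OF weighted_tau_sum_tendsto, of 2] by simp
  show "\<forall>\<^sub>F z in hp. norm (newton_remainder (fst z) (snd z)) \<le> 2 * ?w z"
    using tau_sum_ratio_tendsto(2)[OF est_error_tendsto] eventually_antiderivatives eventually_pos
  proof eventually_elim
    case (elim z)
    obtain n \<omega> where z: "z = (n, \<omega>)"
      by fastforce
    let ?t = "estv n \<omega>" and ?D = "\<bar>estv n \<omega> - \<theta>\<bar>"
    let ?r = "enn2real (tau_sum n ?D \<omega>)"
    have fin: "tau_sum n ?D \<omega> < \<infinity>" and reg: "antiderivatives n \<omega>" and "I n > 0"
      using elim by (auto simp: z)
    have 1: "\<bar>score n ?t \<omega> - score n \<theta> \<omega> - (?t - \<theta>) * slope_sum n \<theta> \<omega>\<bar> \<le> ?D * ?r"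
      using reg fin order_refl by (rule score_linearization_error)
    have "\<bar>(?t - \<theta>) * (slope_sum n ?t \<omega> - slope_sum n \<theta> \<omega>)\<bar> \<le> ?D * ?r"
      unfolding abs_mult by (intro mult_left_mono slope_sum_osc fin) auto
    moreover have "score n ?t \<omega> - score n \<theta> \<omega> - (?t - \<theta>) * slope_sum n ?t \<omega>
       = (score n ?t \<omega> - score n \<theta> \<omega> - (?t - \<theta>) * slope_sum n \<theta> \<omega>)
         - (?t - \<theta>) * (slope_sum n ?t \<omega> - slope_sum n \<theta> \<omega>)"
      by (simp add: algebra_simps)
    ultimately have "\<bar>score n ?t \<omega> - score n \<theta> \<omega> - (?t - \<theta>) * slope_sum n ?t \<omega>\<bar> \<le> 2 * (?D * ?r)"
      using 1 by linarith
    then have "\<bar>score n ?t \<omega> - score n \<theta> \<omega> - (?t - \<theta>) * slope_sum n ?t \<omega>\<bar> / sqrt (I n)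
        \<le> 2 * (?D * ?r) / sqrt (I n)"
      using \<open>I n > 0\<close> by (intro divide_right_mono) auto
    then show ?case
      using \<open>I n > 0\<close> by (simp add: z newton_remainder_def abs_divide)
  qed
qed

section \<open>The one-step estimator\<close>

definition step_defd :: "nat \<Rightarrow> 'w \<Rightarrow> bool" where
  "step_defd n \<omega> \<longleftrightarrow> one_step_defined \<Theta> (M' n) n (est n) (sample X n \<omega>)"

definition step :: "nat \<Rightarrow> 'w \<Rightarrow> real" where
  "step n \<omega> = one_step (M n) (M' n) n (est n) (sample X n \<omega>)"

lemma step_defd_iff: "step_defd n \<omega> \<longleftrightarrow> estv n \<omega> \<in> \<Theta> \<and> slope_sum n (estv n \<omega>) \<omega> \<noteq> 0"
  by (simp add: step_defd_def one_step_defined_def estv_def slope_sum_def)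

lemma step_eq: "step n \<omega> = estv n \<omega> - score n (estv n \<omega>) \<omega> / slope_sum n (estv n \<omega>) \<omega>"
  by (simp add: step_def one_step_def estv_def score_def slope_sum_def)

lemma Theta_sets [measurable]: "\<Theta> \<in> sets borel"
  using Theta(1) by (rule borel_open)

lemma est_in_Theta_sets: "{\<omega>. estv n \<omega> \<in> \<Theta>} \<inter> space (P n) \<in> sets (P n)"
proof -
  have "{\<omega> \<in> space (P n). estv n \<omega> \<in> \<Theta>} \<in> sets (P n)"
    by measurable
  moreover have "{\<omega>. estv n \<omega> \<in> \<Theta>} \<inter> space (P n) = {\<omega> \<in> space (P n). estv n \<omega> \<in> \<Theta>}"
    by blast
  ultimately show ?thesis
    by simp
qed

lemma score_est_meas [measurable]:
  "(\<lambda>\<omega>. if estv n \<omega> \<in> \<Theta> then score n (estv n \<omega>) \<omega> else 0) \<in> borel_measurable (P n)"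
  using measurable_restrict_space_iff[OF est_in_Theta_sets, of 0 borel "\<lambda>\<omega>. score n (estv n \<omega>) \<omega>" n] meas
  by (simp add: measurability_conditions_def score_def estv_def)

lemma slope_est_meas [measurable]:
  "(\<lambda>\<omega>. if estv n \<omega> \<in> \<Theta> then slope_sum n (estv n \<omega>) \<omega> else 0) \<in> borel_measurable (P n)"
  using measurable_restrict_space_iff[OF est_in_Theta_sets, of 0 borel "\<lambda>\<omega>. slope_sum n (estv n \<omega>) \<omega>" n] meas
  by (simp add: measurability_conditions_def slope_sum_def estv_def)

text \<open>
  Extending the slope sum by \<open>0\<close> outside \<open>\<Theta>\<close> turns its measurability on the part where the
  estimator lies in \<open>\<Theta>\<close> into measurability on the whole space, and the one-step estimator is defined
  exactly where the extension is nonzero.  The lemmas on measurability below use this device too.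
\<close>

lemma step_defd_pred [measurable]: "Measurable.pred (P n) (step_defd n)"
proof -
  have "step_defd n = (\<lambda>\<omega>. (if estv n \<omega> \<in> \<Theta> then slope_sum n (estv n \<omega>) \<omega> else 0) \<noteq> 0)"
    by (auto simp: step_defd_iff fun_eq_iff)
  also have "Measurable.pred (P n) \<dots>"
    by measurable
  finally show ?thesis .
qed

lemma step_meas [measurable]: "(\<lambda>\<omega>. if step_defd n \<omega> then step n \<omega> else 0) \<in> borel_measurable (P n)"
proof -
  have "(\<lambda>\<omega>. if step_defd n \<omega> then step n \<omega> else 0) = (\<lambda>\<omega>. if step_defd n \<omega> then estv n \<omega> -
      (if estv n \<omega> \<in> \<Theta> then score n (estv n \<omega>) \<omega> else 0) /
      (if estv n \<omega> \<in> \<Theta> then slope_sum n (estv n \<omega>) \<omega> else 0) else 0)"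
    by (auto simp: step_defd_iff step_eq fun_eq_iff)
  also have "\<dots> \<in> borel_measurable (P n)"
    by measurable
  finally show ?thesis .
qed

lemma eventually_step_defd: "\<forall>\<^sub>F z in hp. step_defd (fst z) (snd z)"
proof -
  have "\<forall>\<^sub>F z in hp. estv (fst z) (snd z) \<in> \<Theta>"
    using estv_tendsto Theta by (rule topological_tendstoD)
  moreover have "\<forall>\<^sub>F z in hp. slope_sum (fst z) (estv (fst z) (snd z)) (snd z) / J (fst z) \<noteq> 0"
    using slope_est_tendsto by (rule tendsto_imp_eventually_ne) simp
  ultimately show ?thesis
    by eventually_elim (simp add: step_defd_iff)
qed

definition scaled_error :: "nat \<Rightarrow> 'w \<Rightarrow> real" where
  "scaled_error n \<omega> = (if step_defd n \<omega> then J n / sqrt (I n) * (step n \<omega> - \<theta>) else 0)"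

lemma scaled_error_meas [measurable]: "scaled_error n \<in> borel_measurable (P n)"
proof -
  have "scaled_error n = (\<lambda>\<omega>. if step_defd n \<omega> then J n / sqrt (I n) * ((if step_defd n \<omega> then step n \<omega> else 0) - \<theta>) else 0)"
    by (auto simp: scaled_error_def)
  also have "\<dots> \<in> borel_measurable (P n)"
    by measurable
  finally show ?thesis .
qed

text \<open>
  Where the estimator is defined, its scaled error is \<open>(Z - \<rho>) / b\<close>, where \<open>Z\<close> is minus the
  standardized score at \<open>\<theta>\<close>, asymptotically normal by symmetry of the limit law, \<open>\<rho>\<close> is the null
  remainder above, and \<open>b\<close>, the normalized slope at the preliminary estimator, tends to \<open>1\<close>.
\<close>

lemma weak_conv_scaled_error: "weak_conv_m (\<lambda>n. distr (P n) borel (scaled_error n)) std_normal_distribution"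
proof (rule weak_conv_perturb[OF prob scaled_error_meas _ real_dist_normal_dist std_normal_atomless])
  let ?Z = "\<lambda>n \<omega>. - (score n \<theta> \<omega> / sqrt (I n))"
  let ?b = "\<lambda>z. slope_sum (fst z) (estv (fst z) (snd z)) (snd z) / J (fst z)"
  show "?Z n \<in> borel_measurable (P n)" for n
    by measurable
  show Z: "weak_conv_m (\<lambda>n. distr (P n) borel (?Z n)) std_normal_distribution"
  proof (rule weak_conv_std_normal_uminus[OF prob])
    show "(\<lambda>\<omega>. score n \<theta> \<omega> / sqrt (I n)) \<in> borel_measurable (P n)" for n
      by measurable
    show "weak_conv_m (\<lambda>n. distr (P n) borel (\<lambda>\<omega>. score n \<theta> \<omega> / sqrt (I n))) std_normal_distribution"
      using clt by (simp only: score_def)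
  qed
  have inv: "((\<lambda>z. 1 / ?b z) \<longlongrightarrow> 1) hp"
    using tendsto_divide[OF tendsto_const slope_est_tendsto, of 1] by simp
  have "((\<lambda>z. (1 / ?b z - 1) * ?Z (fst z) (snd z)) \<longlongrightarrow> 0) hp"
    by (rule tight_mult_null[OF prob _ real_dist_normal_dist std_normal_atomless Z])
      (use inv in \<open>simp_all add: LIM_zero\<close>)
  moreover have "((\<lambda>z. newton_remainder (fst z) (snd z) * (1 / ?b z)) \<longlongrightarrow> 0) hp"
    using tendsto_mult[OF newton_remainder_tendsto inv] by simp
  ultimately have "((\<lambda>z. (1 / ?b z - 1) * ?Z (fst z) (snd z) - newton_remainder (fst z) (snd z) * (1 / ?b z)) \<longlongrightarrow> 0) hp"
    using tendsto_diff by fastforce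
  moreover have "\<forall>\<^sub>F z in hp. (1 / ?b z - 1) * ?Z (fst z) (snd z) - newton_remainder (fst z) (snd z) * (1 / ?b z)
      = scaled_error (fst z) (snd z) - ?Z (fst z) (snd z)"
    using eventually_step_defd eventually_pos
  proof eventually_elim
    case (elim z)
    then have "slope_sum (fst z) (estv (fst z) (snd z)) (snd z) \<noteq> 0" "sqrt (I (fst z)) \<noteq> 0" "J (fst z) \<noteq> 0"
      by (auto simp: step_defd_iff)
    then show ?case
      using elim(1) by (simp add: scaled_error_def step_eq newton_remainder_def field_simps)
  qed
  ultimately show "((\<lambda>z. scaled_error (fst z) (snd z) - ?Z (fst z) (snd z)) \<longlongrightarrow> 0) hp"
    by (rule Lim_transform_eventually)
qed

lemma scaled_error_mult_null: "(A \<longlongrightarrow> 0) hp \<Longrightarrow> ((\<lambda>z. A z * scaled_error (fst z) (snd z)) \<longlongrightarrow> 0) hp"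
  by (rule tight_mult_null[OF prob scaled_error_meas real_dist_normal_dist std_normal_atomless weak_conv_scaled_error])

text \<open>
  The scaled error is tight and its scale \<open>\<bar>J\<^sub>n\<bar> / \<surd>I\<^sub>n\<close> tends to infinity.
\<close>

lemma step_tendsto: "((\<lambda>z. step (fst z) (snd z) - \<theta>) \<longlongrightarrow> 0) hp"
proof -
  have "(\<lambda>n. inverse (\<bar>J n\<bar> / sqrt (I n))) \<longlonglongrightarrow> 0"
    using ratio by (rule tendsto_inverse_0_at_top)
  moreover have "\<forall>\<^sub>F n in sequentially. inverse (\<bar>J n\<bar> / sqrt (I n)) = \<bar>sqrt (I n) / J n\<bar>"
    using pos by eventually_elim (simp add: abs_divide)
  ultimately have "(\<lambda>n. \<bar>sqrt (I n) / J n\<bar>) \<longlonglongrightarrow> 0"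
    by (rule Lim_transform_eventually)
  then have "(\<lambda>n. sqrt (I n) / J n) \<longlonglongrightarrow> 0"
    by (rule tendsto_rabs_zero_cancel)
  then have "((\<lambda>z. sqrt (I (fst z)) / J (fst z)) \<longlongrightarrow> 0) hp"
    using filterlim_fst_whp by (rule filterlim_compose)
  then have "((\<lambda>z. sqrt (I (fst z)) / J (fst z) * scaled_error (fst z) (snd z)) \<longlongrightarrow> 0) hp"
    by (rule scaled_error_mult_null)
  moreover have "\<forall>\<^sub>F z in hp. sqrt (I (fst z)) / J (fst z) * scaled_error (fst z) (snd z) = step (fst z) (snd z) - \<theta>"
    using eventually_step_defd eventually_pos
    by eventually_elim (simp add: scaled_error_def)
  ultimately show ?thesis
    by (rule Lim_transform_eventually)
qed

lemma eventually_step_in_Theta: "\<forall>\<^sub>F z in hp. step (fst z) (snd z) \<in> \<Theta>"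
proof -
  have "((\<lambda>z. step (fst z) (snd z)) \<longlongrightarrow> \<theta>) hp"
    using step_tendsto by (simp add: LIM_zero_iff)
  then show ?thesis
    using Theta by (rule topological_tendstoD)
qed

section \<open>Studentization\<close>

definition sq_resid :: "nat \<Rightarrow> 'w \<Rightarrow> real" where
  "sq_resid n \<omega> = sq_total (M n) (M' n) n (est n) (sample X n \<omega>)"

lemma sqrt_sq_resid: "sqrt (sq_resid n \<omega>) = L2_set (\<lambda>i. M n i (step n \<omega>) (X n i \<omega>)) {1..n}"
  by (simp add: sq_resid_def sq_total_def sample_sum_sample step_def L2_set_def)

text \<open>
  By the triangle inequality it suffices to bound the \<open>\<ell>\<^sup>2\<close> norm of the increments of the scores,
  each of which is a linear term plus a linearization error; the \<open>\<ell>\<^sup>2\<close> norm of the errors is at most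
  their \<open>\<ell>\<^sup>1\<close> norm.
\<close>

lemma L2_score_osc:
  assumes "antiderivatives n \<omega>" "tau_sum n \<delta> \<omega> < \<infinity>" "\<bar>t - \<theta>\<bar> \<le> \<delta>"
  shows "\<bar>L2_set (\<lambda>i. M n i t (X n i \<omega>)) {1..n} - L2_set (\<lambda>i. M n i \<theta> (X n i \<omega>)) {1..n}\<bar>
    \<le> \<bar>t - \<theta>\<bar> * (enn2real (tau_sum n \<delta> \<omega>) + L2_set (\<lambda>i. M' n i \<theta> (X n i \<omega>)) {1..n})"
proof -
  let ?e = "\<lambda>i. M n i t (X n i \<omega>) - M n i \<theta> (X n i \<omega>) - (t - \<theta>) * M' n i \<theta> (X n i \<omega>)"
  have "\<bar>L2_set (\<lambda>i. M n i t (X n i \<omega>)) {1..n} - L2_set (\<lambda>i. M n i \<theta> (X n i \<omega>)) {1..n}\<bar>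
      \<le> L2_set (\<lambda>i. ?e i + (t - \<theta>) * M' n i \<theta> (X n i \<omega>)) {1..n}"
    by (rule order_trans[OF abs_diff_L2_set_le]) simp
  also have "\<dots> \<le> L2_set ?e {1..n} + L2_set (\<lambda>i. (t - \<theta>) * M' n i \<theta> (X n i \<omega>)) {1..n}"
    by (rule L2_set_triangle_ineq)
  also have "L2_set ?e {1..n} \<le> \<bar>t - \<theta>\<bar> * enn2real (tau_sum n \<delta> \<omega>)"
    using L2_set_le_sum_abs sum_linearization_error[OF assms] by (rule order_trans)
  finally show ?thesis
    by (simp add: L2_set_cmult distrib_left)
qed

text \<open>
  At \<open>t = \<theta>\<^sub>n\<^sup>*\<^sup>*\<close> the bound of \<open>L2_score_osc\<close>, divided by \<open>\<surd>I\<^sub>n\<close>, is the tight scaled error times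
  \<open>\<Sum>\<^sub>i \<tau>\<^sub>i / \<bar>J\<^sub>n\<bar>\<close> plus the root of the normalized sum of squared slopes, and both of these are null.
\<close>

lemma studentizing_variance_tendsto:
  assumes sq: "conv_in_prob P
            (\<lambda>n \<omega>. sample_sum (\<lambda>i t y. (M n i t y)\<^sup>2) n \<theta> (sample X n \<omega>) / I n) 1"
    and sq': "conv_in_prob P
            (\<lambda>n \<omega>. sample_sum (\<lambda>i t y. (M' n i t y)\<^sup>2) n \<theta> (sample X n \<omega>) / (J n)\<^sup>2) 0"
  shows "((\<lambda>z. sqrt (sq_resid (fst z) (snd z)) / sqrt (I (fst z))) \<longlongrightarrow> 1) hp"
proof -
  let ?q = "\<lambda>n \<omega>. sample_sum (\<lambda>i t y. (M n i t y)\<^sup>2) n \<theta> (sample X n \<omega>)"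
  let ?s = "\<lambda>n \<omega>. sample_sum (\<lambda>i t y. (M' n i t y)\<^sup>2) n \<theta> (sample X n \<omega>)"
  have "((\<lambda>z. ?q (fst z) (snd z) / I (fst z)) \<longlongrightarrow> 1) hp"
    by (rule tendsto_whp_conv_in_prob[OF prob _ sq], unfold sample_sum_sample)
      (intro borel_measurable_divide borel_measurable_sum borel_measurable_power borel_measurable_const summand_meas)
  from tendsto_real_sqrt[OF this]
  have q: "((\<lambda>z. sqrt (?q (fst z) (snd z)) / sqrt (I (fst z))) \<longlongrightarrow> 1) hp"
    by (simp add: real_sqrt_divide)
  have "((\<lambda>z. ?s (fst z) (snd z) / (J (fst z))\<^sup>2) \<longlongrightarrow> 0) hp"
    by (rule tendsto_whp_conv_in_prob[OF prob _ sq'], unfold sample_sum_sample)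
      (intro borel_measurable_divide borel_measurable_sum borel_measurable_power borel_measurable_const summand_meas)
  from tendsto_real_sqrt[OF this]
  have s: "((\<lambda>z. sqrt (?s (fst z) (snd z)) / \<bar>J (fst z)\<bar>) \<longlongrightarrow> 0) hp"
    by (simp add: real_sqrt_divide)
  let ?r = "\<lambda>z. enn2real (tau_sum (fst z) \<bar>step (fst z) (snd z) - \<theta>\<bar> (snd z)) / \<bar>J (fst z)\<bar>
      + sqrt (?s (fst z) (snd z)) / \<bar>J (fst z)\<bar>"
  have "(?r \<longlongrightarrow> 0) hp"
    using tendsto_add[OF tau_sum_ratio_tendsto(1)[OF step_tendsto] s] by simp
  from tendsto_rabs[OF scaled_error_mult_null[OF this]]
  have r: "((\<lambda>z. \<bar>?r z * scaled_error (fst z) (snd z)\<bar>) \<longlongrightarrow> 0) hp"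
    by simp
  have "((\<lambda>z. sqrt (sq_resid (fst z) (snd z)) / sqrt (I (fst z))
        - sqrt (?q (fst z) (snd z)) / sqrt (I (fst z))) \<longlongrightarrow> 0) hp"
  proof (rule Lim_null_comparison[OF _ r])
    show "\<forall>\<^sub>F z in hp. norm (sqrt (sq_resid (fst z) (snd z)) / sqrt (I (fst z))
        - sqrt (?q (fst z) (snd z)) / sqrt (I (fst z))) \<le> \<bar>?r z * scaled_error (fst z) (snd z)\<bar>"
      using tau_sum_ratio_tendsto(2)[OF step_tendsto] eventually_antiderivatives eventually_pos eventually_step_defd
    proof eventually_elim
      case (elim z)
      obtain n \<omega> where z: "z = (n, \<omega>)"
        by fastforce
      let ?D = "\<bar>step n \<omega> - \<theta>\<bar>"
      let ?c = "enn2real (tau_sum n ?D \<omega>) + sqrt (?s n \<omega>)"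
      have I: "I n > 0" and J: "J n \<noteq> 0"
        using elim by (auto simp: z)
      have q_eq: "sqrt (?q n \<omega>) = L2_set (\<lambda>i. M n i \<theta> (X n i \<omega>)) {1..n}"
        and s_eq: "sqrt (?s n \<omega>) = L2_set (\<lambda>i. M' n i \<theta> (X n i \<omega>)) {1..n}"
        by (simp_all add: sample_sum_sample L2_set_def)
      have "\<bar>sqrt (sq_resid n \<omega>) - sqrt (?q n \<omega>)\<bar> \<le> ?D * ?c"
        unfolding sqrt_sq_resid q_eq s_eq using elim by (intro L2_score_osc) (auto simp: z)
      then have "\<bar>sqrt (sq_resid n \<omega>) - sqrt (?q n \<omega>)\<bar> / sqrt (I n) \<le> ?D * ?c / sqrt (I n)"
        using I by (intro divide_right_mono) auto
      also have "?D * ?c / sqrt (I n) = ?c / \<bar>J n\<bar> * \<bar>scaled_error n \<omega>\<bar>"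
        using elim I J by (simp add: z scaled_error_def abs_mult abs_divide)
      also have "\<dots> \<le> \<bar>?c / \<bar>J n\<bar> * scaled_error n \<omega>\<bar>"
        unfolding abs_mult by (intro mult_right_mono abs_ge_self) simp
      finally show ?case
        using I by (simp add: z diff_divide_distrib[symmetric] add_divide_distrib[symmetric] abs_divide)
    qed
  qed
  from tendsto_add[OF this q] show ?thesis
    by simp
qed

definition stud_defd :: "nat \<Rightarrow> 'w \<Rightarrow> bool" where
  "stud_defd n \<omega> \<longleftrightarrow> studentizer_defined \<Theta> (M n) (M' n) n (est n) (sample X n \<omega>)"

definition stud_error :: "nat \<Rightarrow> 'w \<Rightarrow> real" where
  "stud_error n \<omega> = (if stud_defd n \<omega> then studentizer (M n) (M' n) n (est n) (sample X n \<omega>)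
                    * (step n \<omega> - \<theta>) else 0)"

lemma stud_defd_iff: "stud_defd n \<omega> \<longleftrightarrow> step_defd n \<omega> \<and> step n \<omega> \<in> \<Theta> \<and> sq_resid n \<omega> \<noteq> 0"
  by (simp add: stud_defd_def studentizer_defined_def step_defd_def step_def sq_resid_def)

lemma studentizer_eq:
  "studentizer (M n) (M' n) n (est n) (sample X n \<omega>) = slope_sum n (estv n \<omega>) \<omega> / sqrt (sq_resid n \<omega>)"
  by (simp add: studentizer_def slope_sum_def estv_def sq_resid_def)

lemma stud_error_meas [measurable]: "stud_error n \<in> borel_measurable (P n)"
proof -
  let ?A = "{\<omega>. step_defd n \<omega> \<and> step n \<omega> \<in> \<Theta>}"
  have eq: "?A \<inter> space (P n) = {\<omega> \<in> space (P n). step_defd n \<omega> \<and> (if step_defd n \<omega> then step n \<omega> else 0) \<in> \<Theta>}"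
    by auto
  have A: "?A \<inter> space (P n) \<in> sets (P n)"
    unfolding eq by measurable
  have [measurable]: "(\<lambda>\<omega>. if \<omega> \<in> ?A then sq_resid n \<omega> else 0) \<in> borel_measurable (P n)"
    using measurable_restrict_space_iff[OF A, of 0 borel "sq_resid n"] meas
    by (simp add: measurability_conditions_def sq_resid_def[abs_def] step_defd_def step_def)
  have "stud_error n = (\<lambda>\<omega>. if (if \<omega> \<in> ?A then sq_resid n \<omega> else 0) \<noteq> 0
      then (if estv n \<omega> \<in> \<Theta> then slope_sum n (estv n \<omega>) \<omega> else 0)
        / sqrt (if \<omega> \<in> ?A then sq_resid n \<omega> else 0) * ((if step_defd n \<omega> then step n \<omega> else 0) - \<theta>) else 0)"
    by (auto simp: stud_error_def stud_defd_iff studentizer_eq fun_eq_iff step_defd_iff)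
  also have "\<dots> \<in> borel_measurable (P n)"
    by measurable
  finally show ?thesis .
qed

lemma weak_conv_stud_error:
  assumes "conv_in_prob P
            (\<lambda>n \<omega>. sample_sum (\<lambda>i t y. (M n i t y)\<^sup>2) n \<theta> (sample X n \<omega>) / I n) 1"
    and "conv_in_prob P
            (\<lambda>n \<omega>. sample_sum (\<lambda>i t y. (M' n i t y)\<^sup>2) n \<theta> (sample X n \<omega>) / (J n)\<^sup>2) 0"
  shows "weak_conv_m (\<lambda>n. distr (P n) borel (stud_error n)) std_normal_distribution"
proof (rule weak_conv_perturb[OF prob stud_error_meas scaled_error_meas real_dist_normal_dist std_normal_atomless weak_conv_scaled_error])
  let ?b = "\<lambda>z. slope_sum (fst z) (estv (fst z) (snd z)) (snd z) / J (fst z)"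
  let ?v = "\<lambda>z. sqrt (sq_resid (fst z) (snd z)) / sqrt (I (fst z))"
  have v: "(?v \<longlongrightarrow> 1) hp"
    using assms by (rule studentizing_variance_tendsto)
  have "((\<lambda>z. ?b z / ?v z) \<longlongrightarrow> 1) hp"
    using tendsto_divide[OF slope_est_tendsto v] by simp
  then have "((\<lambda>z. ?b z / ?v z - 1) \<longlongrightarrow> 0) hp"
    by (simp add: LIM_zero)
  then have "((\<lambda>z. (?b z / ?v z - 1) * scaled_error (fst z) (snd z)) \<longlongrightarrow> 0) hp"
    by (rule scaled_error_mult_null)
  moreover have "\<forall>\<^sub>F z in hp. ?v z \<noteq> 0"
    using v by (rule tendsto_imp_eventually_ne) simp
  then have "\<forall>\<^sub>F z in hp. (?b z / ?v z - 1) * scaled_error (fst z) (snd z) = stud_error (fst z) (snd z) - scaled_error (fst z) (snd z)"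
    using eventually_step_defd eventually_step_in_Theta eventually_pos
  proof eventually_elim
    case (elim z)
    obtain n \<omega> where z: "z = (n, \<omega>)"
      by fastforce
    have nz: "sq_resid n \<omega> \<noteq> 0" "sqrt (sq_resid n \<omega>) \<noteq> 0" "sqrt (I n) \<noteq> 0" "J n \<noteq> 0"
      and "step_defd n \<omega>" "step n \<omega> \<in> \<Theta>"
      using elim by (auto simp: z)
    then have "stud_defd n \<omega>"
      by (simp add: stud_defd_iff)
    have "slope_sum n (estv n \<omega>) \<omega> / J n / (sqrt (sq_resid n \<omega>) / sqrt (I n)) * scaled_error n \<omega> = stud_error n \<omega>"
      using nz(2-) \<open>step_defd n \<omega>\<close> \<open>stud_defd n \<omega>\<close> by (simp add: scaled_error_def stud_error_def studentizer_eq)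
    then show ?case
      by (simp add: z left_diff_distrib)
  qed
  ultimately show "((\<lambda>z. stud_error (fst z) (snd z) - scaled_error (fst z) (snd z)) \<longlongrightarrow> 0) hp"
    by (rule Lim_transform_eventually)
qed

end

section \<open>Asymptotic normality\<close>

theorem mainTheorem4:
  fixes P :: "nat \<Rightarrow> 'w measure" and S :: "'x measure" and X :: "nat \<Rightarrow> nat \<Rightarrow> 'w \<Rightarrow> 'x"
    and \<Theta> :: "real set" and \<theta> :: real
    and M M' :: "nat \<Rightarrow> nat \<Rightarrow> real \<Rightarrow> 'x \<Rightarrow> real"
    and est :: "nat \<Rightarrow> (nat \<Rightarrow> 'x) \<Rightarrow> real"
  assumes prob: "\<And>n. prob_space (P n)"
    and indep: "\<And>n. prob_space.indep_vars (P n) (\<lambda>_. S) (X n) {1..n}"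
    and Theta: "open \<Theta>" "\<theta> \<in> \<Theta>"
    and meas: "measurability_conditions P S X \<Theta> \<theta> M M' est"
    and consistent: "conv_in_prob P (\<lambda>n \<omega>. est n (sample X n \<omega>)) \<theta>"
    and i_deriv: "\<And>n. AE \<omega> in P n. \<forall>i\<in>{1..n}. \<forall>t1 t2. t1 \<le> t2 \<longrightarrow> {t1..t2} \<subseteq> \<Theta> \<longrightarrow>
          set_integrable lborel {t1..t2} (\<lambda>t. M' n i t (X n i \<omega>)) \<and>
          M n i t2 (X n i \<omega>) - M n i t1 (X n i \<omega>) = (LBINT t:{t1..t2}. M' n i t (X n i \<omega>))"
    and i_mean: "\<And>n i. i \<in> {1..n} \<Longrightarrow>
          integrable (P n) (\<lambda>\<omega>. M n i \<theta> (X n i \<omega>)) \<and> (\<integral>\<omega>. M n i \<theta> (X n i \<omega>) \<partial>P n) = 0"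
    and i_var: "\<And>n i. i \<in> {1..n} \<Longrightarrow> integrable (P n) (\<lambda>\<omega>. (M n i \<theta> (X n i \<omega>))\<^sup>2)"
    and i_slope: "\<And>n i. i \<in> {1..n} \<Longrightarrow> integrable (P n) (\<lambda>\<omega>. M' n i \<theta> (X n i \<omega>))"
    and ii_pos: "\<forall>\<^sub>F n in sequentially. score_var P X M \<theta> n > 0 \<and> mean_slope P X M' \<theta> n \<noteq> 0"
    and ii_ratio: "filterlim (\<lambda>n. \<bar>mean_slope P X M' \<theta> n\<bar> / sqrt (score_var P X M \<theta> n))
          at_top sequentially"
    and ii_slope: "conv_in_prob P
          (\<lambda>n \<omega>. sample_sum (M' n) n \<theta> (sample X n \<omega>) / mean_slope P X M' \<theta> n) 1"
    and ii_clt: "weak_conv_m (\<lambda>n. distr (P n) borel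
          (\<lambda>\<omega>. sample_sum (M n) n \<theta> (sample X n \<omega>) / sqrt (score_var P X M \<theta> n))) std_normal_distribution"
    and iii: "((\<lambda>\<delta>. limsup (\<lambda>n. tau_bar_sum P X \<Theta> \<theta> M' n \<delta> / ennreal \<bar>mean_slope P X M' \<theta> n\<bar>))
          \<longlongrightarrow> 0) (at_right 0)"
    and iv: "null_in_prob P (\<lambda>n \<omega>.
          ennreal \<bar>est n (sample X n \<omega>) - \<theta>\<bar>
            * tau_bar_sum P X \<Theta> \<theta> M' n \<bar>est n (sample X n \<omega>) - \<theta>\<bar>
            / ennreal (sqrt (score_var P X M \<theta> n)))"
  shows "((\<lambda>n. measure (P n) {\<omega> \<in> space (P n).
            one_step_defined \<Theta> (M' n) n (est n) (sample X n \<omega>)}) \<longlonglongrightarrow> 1) \<and>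
         weak_conv_std_normal P
          (\<lambda>n \<omega>. one_step_defined \<Theta> (M' n) n (est n) (sample X n \<omega>))
          (\<lambda>n \<omega>. mean_slope P X M' \<theta> n / sqrt (score_var P X M \<theta> n)
                    * (one_step (M n) (M' n) n (est n) (sample X n \<omega>) - \<theta>)) \<and>
         (conv_in_prob P (\<lambda>n \<omega>.
            sample_sum (\<lambda>i t y. (M n i t y)\<^sup>2) n \<theta> (sample X n \<omega>) / score_var P X M \<theta> n) 1 \<and>
          conv_in_prob P (\<lambda>n \<omega>.
            sample_sum (\<lambda>i t y. (M' n i t y)\<^sup>2) n \<theta> (sample X n \<omega>) / (mean_slope P X M' \<theta> n)\<^sup>2) 0
          \<longrightarrow> weak_conv_std_normal P
          (\<lambda>n \<omega>. studentizer_defined \<Theta> (M n) (M' n) n (est n) (sample X n \<omega>))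
          (\<lambda>n \<omega>. studentizer (M n) (M' n) n (est n) (sample X n \<omega>)
                    * (one_step (M n) (M' n) n (est n) (sample X n \<omega>) - \<theta>)))"
proof -
  have X_meas: "X n i \<in> measurable (P n) S" if "i \<in> {1..n}" for n i
  proof -
    have "\<forall>i\<in>{1..n}. X n i \<in> measurable (P n) S"
      using indep[of n] unfolding prob_space.indep_vars_def[OF prob[of n]] by (rule conjunct1)
    then show ?thesis
      using that by (rule bspec)
  qed
  interpret M_estimation P S X \<Theta> \<theta> M M' est
    by (rule M_estimation.intro[OF prob X_meas Theta meas consistent i_deriv ii_pos ii_ratio
        ii_slope ii_clt iii iv])
  have "(\<lambda>n. measure (P n) {\<omega> \<in> space (P n). step_defd n \<omega>}) \<longlonglongrightarrow> 1"
    by (rule measure_tendsto_1_whp[OF prob _ eventually_step_defd]) measurable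
  then show ?thesis
    unfolding weak_conv_std_normal_def
    using weak_conv_scaled_error[unfolded scaled_error_def[abs_def] step_defd_def step_def]
      weak_conv_stud_error[unfolded stud_error_def[abs_def] stud_defd_def step_def]
    by (intro conjI impI) (simp_all only: step_defd_def)
qed

end
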